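(* Let $X=\mathbb{P}^1\times\mathbb{P}^1$ over $\mathbb{C}$, let $P_1,\dots,P_s\in X$ be mutually distinct points and let $I=\bigcap_{i} I(P_i)\subset\mathbb{C}[X]$ be the ideal of their union. Then for every integer $m\geq 1$ $$\frac{\alpha^{*}(I^{(m)})}{m}\geq\frac{\alpha^{*}(I)}{2}.$$
   Context: $\mathbb{C}[X]=\mathbb{C}[x_0,x_1;y_0,y_1]$ is the bigraded coordinate ring of $X=\mathbb{P}^1\times\mathbb{P}^1$, and $\mathcal{O}_X(a,b)$ is the line bundle of bi-degree $(a,b)$. For a point $P=([a:b],[c:d])$, $I(P)$ is the prime ideal generated by $bx_0-ax_1$ and $dy_0-cy_1$. For $I=\bigcap_{i=1}^s I(P_i)$ the $m$-th symbolic power is $I^{(m)}=\bigcap_{i=1}^s I(P_i)^m$; thus a bi-homogeneous form lies in $I^{(m)}$ exactly when it vanishes to order at least $m$ at each $P_i$. For a non-zero bi-homogeneous ideal $J\subset\mathbb{C}[X]$, $\alpha^{*}(J)$ is the least integer $k\ge 0$ such that $J$ contains a non-zero form of bi-degree $(k,k)$, i.e. $H^0(\mathcal{O}_X(k,k)\otimes J)\neq 0$. *)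

theory Defs
  imports
    "HOL-Library.Poly_Mapping"
    "HOL-Algebra.Ideal_Product"
    "HOL-Algebra.Algebraic_Closure_Type"
    Complex_Main
begin

section \<open>The bigraded coordinate ring of the product of two projective lines\<close>

datatype var = X0 | X1 | Y0 | Y1

text \<open>The order on the variables has no mathematical meaning here. It is what
  \<^theory>\<open>HOL-Library.Poly_Mapping\<close> requires in order to know that the polynomial ring is an
  integral domain.\<close>

fun var_index :: "var \<Rightarrow> nat" where
  "var_index X0 = 0"
| "var_index X1 = 1"
| "var_index Y0 = 2"
| "var_index Y1 = 3"

lemma inj_var_index: "inj var_index"
proof (rule injI)
  fix u v assume "var_index u = var_index v"
  then show "u = v" by (cases u; cases v) simp_all
qed

instantiation var :: linorder
begin

definition less_eq_var :: "var \<Rightarrow> var \<Rightarrow> bool" where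
  "u \<le> v \<longleftrightarrow> var_index u \<le> var_index v"

definition less_var :: "var \<Rightarrow> var \<Rightarrow> bool" where
  "u < v \<longleftrightarrow> var_index u < var_index v"

instance
  by standard (auto simp: less_eq_var_def less_var_def dest: injD[OF inj_var_index])

end

text \<open>Monomials are exponent vectors, and a polynomial maps finitely many of them to their
  non-zero coefficients.\<close>

type_synonym bipoly = "(var \<Rightarrow>\<^sub>0 nat) \<Rightarrow>\<^sub>0 complex"

definition Const :: "complex \<Rightarrow> bipoly" where
  "Const c = Poly_Mapping.single 0 c"

definition Var :: "var \<Rightarrow> bipoly" where
  "Var v = Poly_Mapping.single (Poly_Mapping.single v 1) 1"

abbreviation CX :: "bipoly ring" where
  "CX \<equiv> ring_of_type_algebra"

text \<open>As usual, the zero polynomial is a form of every bi-degree.\<close>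

definition biform :: "nat \<Rightarrow> nat \<Rightarrow> bipoly \<Rightarrow> bool" where
  "biform k l f \<longleftrightarrow> (\<forall>t \<in> Poly_Mapping.keys f.
     Poly_Mapping.lookup t X0 + Poly_Mapping.lookup t X1 = k \<and>
     Poly_Mapping.lookup t Y0 + Poly_Mapping.lookup t Y1 = l)"

text \<open>The minimum exists whenever \<open>J\<close> is a non-zero bi-homogeneous ideal: a non-zero form of
  bi-degree \<open>(a, b)\<close> can be multiplied up to bi-degree \<open>(max a b, max a b)\<close>. For other sets \<open>J\<close>
  the value can be unspecified.\<close>

definition alpha_star :: "bipoly set \<Rightarrow> nat" where
  "alpha_star J = (LEAST k. \<exists>f \<in> J. f \<noteq> 0 \<and> biform k k f)"


section \<open>Points and their ideals\<close>

definition proportional :: "complex \<times> complex \<Rightarrow> complex \<times> complex \<Rightarrow> bool" where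
  "proportional v w \<longleftrightarrow>
     v \<noteq> (0, 0) \<and> (\<exists>c. c \<noteq> 0 \<and> w = (c * fst v, c * snd v))"

lemma part_equivp_proportional: "part_equivp proportional"
proof (rule part_equivpI)
  show "\<exists>v. proportional v v"
    by (rule exI[of _ "(1, 1)"]) (auto simp: proportional_def intro: exI[of _ 1])
  show "symp proportional"
  proof (rule sympI)
    fix v w assume "proportional v w"
    then obtain c where c: "v \<noteq> (0, 0)" "c \<noteq> 0" "w = (c * fst v, c * snd v)"
      unfolding proportional_def by blast
    then have "v = (inverse c * fst w, inverse c * snd w)" by (cases v) simp
    moreover have "w \<noteq> (0, 0)" using c by (cases v) auto
    ultimately show "proportional w v"
      unfolding proportional_def using c(2) by (metis nonzero_imp_inverse_nonzero)
  qed
  show "transp proportional"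
  proof (rule transpI)
    fix u v w assume "proportional u v" "proportional v w"
    then obtain c d where "u \<noteq> (0, 0)" "c \<noteq> 0" "v = (c * fst u, c * snd u)"
      "d \<noteq> 0" "w = (d * fst v, d * snd v)"
      unfolding proportional_def by blast
    then show "proportional u w"
      unfolding proportional_def by (auto intro!: exI[of _ "d * c"])
  qed
qed

text \<open>The relation is partial, being reflexive only at non-zero vectors, so the quotient below
  consists of the classes \<open>[a : b]\<close> with \<open>(a, b) \<noteq> (0, 0)\<close>.\<close>

quotient_type proj_line = "complex \<times> complex" / partial: proportional
  by (rule part_equivp_proportional)

lemma Idl_scaled_generators:
  assumes c: "c \<noteq> 0" and d: "d \<noteq> 0"
  shows "Idl\<^bsub>CX\<^esub> {Const c * f, Const d * g} = Idl\<^bsub>CX\<^esub> {f, g}"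
proof -
  have inv: "Const (inverse e) * (Const e * h) = h" if "e \<noteq> 0" for e h
    using that by (simp add: Const_def mult_single flip: mult.assoc)
  have closed: "x * y \<in> I" if "ideal I CX" "y \<in> I" for I and x y :: bipoly
    using ideal.I_l_closed[OF that, of x] by (simp add: ring_of_type_algebra_def)
  have "{Const c * f, Const d * g} \<subseteq> I \<longleftrightarrow> {f, g} \<subseteq> I" if "ideal I CX" for I
    using closed[OF that] inv[OF c, of f] inv[OF d, of g] by (metis insert_subset empty_subsetI)
  then show ?thesis
    unfolding genideal_def by (metis (no_types, lifting))
qed

lift_definition point_ideal_aux :: "proj_line \<Rightarrow> proj_line \<Rightarrow> bipoly set" is
  "\<lambda>(a, b) (c, d). Idl\<^bsub>CX\<^esub> {Const b * Var X0 - Const a * Var X1,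
                              Const d * Var Y0 - Const c * Var Y1}"
proof -
  fix p p' q q' :: "complex \<times> complex"
  assume "proportional p p'" "proportional q q'"
  then obtain e k where e: "e \<noteq> 0" "p' = (e * fst p, e * snd p)"
    and k: "k \<noteq> 0" "q' = (k * fst q, k * snd q)"
    unfolding proportional_def by blast
  obtain a b c d where ab: "p = (a, b)" and cd: "q = (c, d)" by (cases p; cases q)
  have cm: "Const (x * y) = Const x * Const y" for x y
    by (simp add: Const_def mult_single)
  have scale: "Const (x * y) * u - Const (x * z) * v = Const x * (Const y * u - Const z * v)"
    for x y z u v
    by (simp add: cm algebra_simps)
  show "(case p of (a, b) \<Rightarrow> \<lambda>(c, d).
            Idl\<^bsub>CX\<^esub> {Const b * Var X0 - Const a * Var X1, Const d * Var Y0 - Const c * Var Y1}) q =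
        (case p' of (a, b) \<Rightarrow> \<lambda>(c, d).
            Idl\<^bsub>CX\<^esub> {Const b * Var X0 - Const a * Var X1, Const d * Var Y0 - Const c * Var Y1}) q'"
    using Idl_scaled_generators[OF e(1) k(1)]
    by (simp add: e(2) k(2) ab cd scale)
qed

type_synonym point = "proj_line \<times> proj_line"

definition point_ideal :: "point \<Rightarrow> bipoly set" where
  "point_ideal P = point_ideal_aux (fst P) (snd P)"

definition points_ideal :: "(nat \<Rightarrow> point) \<Rightarrow> nat \<Rightarrow> bipoly set" where
  "points_ideal P s = (\<Inter>i\<in>{1..s}. point_ideal (P i))"

text \<open>Powers are taken in the multiplicative monoid of ideals of the coordinate ring.\<close>

definition symbolic_power :: "(nat \<Rightarrow> point) \<Rightarrow> nat \<Rightarrow> nat \<Rightarrow> bipoly set" where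
  "symbolic_power P s m = (\<Inter>i\<in>{1..s}. point_ideal (P i) [^]\<^bsub>ideals_set CX\<^esub> m)"

end

theory Submission
  imports Defs
begin

text \<open>In an affine chart, a form of bi-degree \<open>(k, k)\<close> is a polynomial in \<open>x\<close> and \<open>y\<close> of degree at
  most \<open>k\<close> in each variable. Let \<open>\<alpha> = \<alpha>*(I) \<ge> 1\<close>. No non-zero polynomial of bi-degree
  \<open>(\<alpha> - 1, \<alpha> - 1)\<close> vanishes at all the points, so at least \<open>\<alpha>\<^sup>2\<close> of them, forming a set \<open>W\<close>,
  impose independent conditions and admit interpolation in that bi-degree. Interpolation shows that
  the polynomials of bi-degree \<open>(\<alpha>, \<alpha>)\<close> vanishing on \<open>W\<close> have no common divisor. So if \<open>f\<close> is given
  by a form in the symbolic power, one of these polynomials, \<open>g\<close>, is coprime to \<open>f\<close>. By a Bezout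
  inequality on the product of two lines, \<open>m * \<alpha>\<^sup>2 \<le> m * card W \<le> 2 * k * \<alpha>\<close>.\<close>

text \<open>The Bezout inequality is reached by linear algebra, without local intersection numbers.
  Composed with multiplication by \<open>g\<close>, which vanishes at the points of
  \<open>W\<close>, a jet functional of order below \<open>m\<close> becomes a combination of jet
  functionals of order below \<open>m - 1\<close>. A point has \<open>m\<close> more of the former
  than of the latter, and this is the factor \<open>m\<close>. The right side is the intersection
  number of curves of bi-degrees (k, k) and (\<alpha>, \<alpha>), obtained as a codimension. That
  codimension is controlled by leading monomials, which forces a chart in which the corner
  coefficient of \<open>f\<close> is non-zero. Passing to \<open>W\<close> matters because a single
  curve may be the only one of bi-degree (\<alpha>, \<alpha>) through all the points, leaving no
  choice of a coprime \<open>g\<close>.\<close>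

lemma homogeneous_system_nontrivial:
  fixes A :: "'e \<Rightarrow> 'j \<Rightarrow> 'a::field"
  assumes "finite E" "finite J" "card E < card J"
  shows "\<exists>c. (\<exists>j\<in>J. c j \<noteq> 0) \<and> (\<forall>e\<in>E. (\<Sum>j\<in>J. c j * A e j) = 0)"
  using assms
proof (induction E arbitrary: J A rule: finite_induct)
  case empty
  then have "J \<noteq> {}" by auto
  then show ?case by (intro exI[of _ "\<lambda>_. 1"]) auto
next
  case (insert e E)
  show ?case
  proof (cases "\<forall>j\<in>J. A e j = 0")
    case True
    have "card E < card J" using insert by simp
    from insert.IH[OF insert.prems(1) this, of A] show ?thesis using True by auto
  next
    case False
    then obtain k where k: "k \<in> J" "A e k \<noteq> 0" by blast
    define J' where "J' = J - {k}"
    have J': "finite J'" "card E < card J'" "k \<notin> J'" "J = insert k J'"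
      using insert k by (auto simp: J'_def)
    \<comment> \<open>Gaussian elimination: equation \<open>e\<close> is solved for the unknown
      \<open>k\<close> and substituted into the others.\<close>
    from insert.IH[OF J'(1,2), of "\<lambda>e' j. A e' j - A e j / A e k * A e' k"]
    obtain c where c: "\<exists>j\<in>J'. c j \<noteq> 0"
      "\<And>e'. e' \<in> E \<Longrightarrow> (\<Sum>j\<in>J'. c j * (A e' j - A e j / A e k * A e' k)) = 0" by blast
    define c' where "c' = c(k := - (\<Sum>j\<in>J'. c j * A e j / A e k))"
    have eq: "(\<Sum>j\<in>J. c' j * A e' j) = (\<Sum>j\<in>J'. c j * (A e' j - A e j / A e k * A e' k))" for e'
    proof -
      have "(\<Sum>j\<in>J'. c' j * A e' j) = (\<Sum>j\<in>J'. c j * A e' j)"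
        using J'(3) by (intro sum.cong) (auto simp: c'_def)
      then show ?thesis
        using J' by (simp add: c'_def sum_subtractf algebra_simps sum_distrib_left)
    qed
    have "\<exists>j\<in>J. c' j \<noteq> 0" using c(1) J' by (auto simp: c'_def)
    moreover have "(\<Sum>j\<in>J. c' j * A e j) = 0" unfolding eq using k(2) by simp
    ultimately show ?thesis using c(2) eq by auto
  qed
qed

section \<open>Bivariate polynomials\<close>

text \<open>The inner polynomials are in \<open>x\<close>, the outer ones in \<open>y\<close>: \<open>coeff2 h i j\<close> is the coefficient
  of \<open>x ^ i * y ^ j\<close>.\<close>

abbreviation coeff2 :: "'a::zero poly poly \<Rightarrow> nat \<Rightarrow> nat \<Rightarrow> 'a" where
  "coeff2 h i j \<equiv> coeff (coeff h j) i"

abbreviation const2 :: "'a::zero \<Rightarrow> 'a poly poly" where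
  "const2 c \<equiv> [:[:c:]:]"

definition mon :: "nat \<Rightarrow> nat \<Rightarrow> complex poly poly" where
  "mon i j = monom (monom 1 i) j"

definition box :: "nat \<Rightarrow> complex poly poly set" where
  "box N = {h. \<forall>i j. coeff2 h i j \<noteq> 0 \<longrightarrow> i \<le> N \<and> j \<le> N}"

lemma coeff2_mult:
  fixes f g :: "'a::comm_semiring_0 poly poly"
  shows "coeff2 (f * g) i j = (\<Sum>j'\<le>j. \<Sum>i'\<le>i. coeff2 f i' j' * coeff2 g (i - i') (j - j'))"
  by (simp add: coeff_mult coeff_sum)

lemma coeff2_const_mult [simp]: "coeff2 (const2 c * h) i j = c * coeff2 h i j"
  for h :: "'a::comm_semiring_0 poly poly"
  by simp

lemma coeff2_mon: "coeff2 (mon i j) i' j' = (if i' = i \<and> j' = j then 1 else 0)"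
  by (simp add: mon_def)

lemma mon_mult: "mon i j * mon k l = mon (i + k) (j + l)"
  by (simp add: mon_def mult_monom)

lemma mon_0_0 [simp]: "mon 0 0 = 1"
  by (simp add: mon_def)

lemma poly2_eqI: "(\<And>i j. coeff2 f i j = coeff2 g i j) \<Longrightarrow> f = g"
  by (intro poly_eqI)

lemma box_add: "f \<in> box N \<Longrightarrow> g \<in> box N \<Longrightarrow> f + g \<in> box N"
  unfolding box_def by (simp add: mem_Collect_eq) (metis add.right_neutral)

lemma box_uminus: "f \<in> box N \<Longrightarrow> - f \<in> box N"
  unfolding box_def by simp

lemma box_diff: "f \<in> box N \<Longrightarrow> g \<in> box N \<Longrightarrow> f - g \<in> box N"
  using box_add[OF _ box_uminus] by fastforce

lemma box_const_mult: "f \<in> box N \<Longrightarrow> const2 c * f \<in> box N"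
  unfolding box_def by auto

lemma box_0 [simp]: "0 \<in> box N"
  by (simp add: box_def)

lemma box_sum: "(\<And>x. x \<in> S \<Longrightarrow> f x \<in> box N) \<Longrightarrow> sum f S \<in> box N"
  by (induction S rule: infinite_finite_induct) (auto intro: box_add)

lemma box_mult:
  assumes "f \<in> box a" "g \<in> box b"
  shows "f * g \<in> box (a + b)"
  unfolding box_def
proof (intro CollectI allI impI)
  fix i j assume "coeff2 (f * g) i j \<noteq> 0"
  then obtain j' where j': "j' \<le> j" "(\<Sum>i'\<le>i. coeff2 f i' j' * coeff2 g (i - i') (j - j')) \<noteq> 0"
    unfolding coeff2_mult by (metis (no_types, lifting) atMost_iff sum.neutral)
  then obtain i' where i': "i' \<le> i" "coeff2 f i' j' * coeff2 g (i - i') (j - j') \<noteq> 0"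
    by (metis (no_types, lifting) atMost_iff sum.neutral)
  then show "i \<le> a + b \<and> j \<le> a + b" using assms j'(1) unfolding box_def by fastforce
qed

lemma box_mono: "a \<le> b \<Longrightarrow> box a \<subseteq> box b"
  unfolding box_def by fastforce

lemma mon_in_box [simp]: "mon i j \<in> box N \<longleftrightarrow> i \<le> N \<and> j \<le> N"
  unfolding box_def by (auto simp: coeff2_mon)

lemma sum_mon:
  assumes "finite S"
  shows "coeff2 (\<Sum>t\<in>S. const2 (c t) * mon (fst t) (snd t)) i j = (if (i, j) \<in> S then c (i, j) else 0)"
proof -
  have "coeff2 (\<Sum>t\<in>S. const2 (c t) * mon (fst t) (snd t)) i j
      = (\<Sum>t\<in>S. if t = (i, j) then c t else 0)"
    unfolding coeff_sum by (intro sum.cong) (auto simp: coeff2_mon split: if_splits)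
  also have "\<dots> = (if (i, j) \<in> S then c (i, j) else 0)" using assms by simp
  finally show ?thesis .
qed

lemma box_expansion:
  assumes "h \<in> box N"
  shows "h = (\<Sum>t\<in>{..N}\<times>{..N}. const2 (coeff2 h (fst t) (snd t)) * mon (fst t) (snd t))"
  by (rule poly2_eqI, subst sum_mon) (use assms in \<open>auto simp: box_def\<close>)

section \<open>Evaluation, Taylor expansion and order of vanishing\<close>

definition eval2 :: "complex \<times> complex \<Rightarrow> complex poly poly \<Rightarrow> complex" where
  "eval2 p h = poly (poly h [:snd p:]) (fst p)"

lemma eval2_simps [simp]:
  "eval2 p (f + g) = eval2 p f + eval2 p g"
  "eval2 p (f - g) = eval2 p f - eval2 p g"
  "eval2 p (- f) = - eval2 p f"
  "eval2 p (f * g) = eval2 p f * eval2 p g"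
  "eval2 p (const2 c) = c"
  "eval2 p 0 = 0" "eval2 p 1 = 1"
  "eval2 p (f ^ n) = eval2 p f ^ n"
  by (simp_all add: eval2_def)

lemma eval2_sum [simp]: "eval2 p (sum f S) = (\<Sum>x\<in>S. eval2 p (f x))"
  by (induction S rule: infinite_finite_induct) auto

lemma eval2_prod [simp]: "eval2 p (prod f S) = (\<Prod>x\<in>S. eval2 p (f x))"
  by (induction S rule: infinite_finite_induct) auto

text \<open>Substituting x + \<open>fst p\<close> and y + \<open>snd p\<close> moves
  \<open>p\<close> to the origin, so the coefficients of the result are the Taylor coefficients at
  \<open>p\<close>. The map is a ring homomorphism, which turns multiplicities into statements about
  coefficients.\<close>

definition taylor :: "complex \<times> complex \<Rightarrow> complex poly poly \<Rightarrow> complex poly poly" where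
  "taylor p h = pcompose (map_poly (\<lambda>q. pcompose q [:fst p, 1:]) h) [:[:snd p:], 1:]"

lemma taylor_add [simp]: "taylor p (f + g) = taylor p f + taylor p g"
proof -
  have "map_poly (\<lambda>q. pcompose q r) (f + g) =
      map_poly (\<lambda>q. pcompose q r) f + map_poly (\<lambda>q. pcompose q r) g" for r
    by (intro poly_eqI) (simp add: coeff_map_poly pcompose_add)
  then show ?thesis by (simp add: taylor_def pcompose_add)
qed

lemma taylor_mult [simp]: "taylor p (f * g) = taylor p f * taylor p g"
proof -
  have "map_poly (\<lambda>q. pcompose q r) (f * g) =
      map_poly (\<lambda>q. pcompose q r) f * map_poly (\<lambda>q. pcompose q r) g" for r
    by (intro poly_eqI) (simp add: coeff_map_poly coeff_mult pcompose_mult pcompose_sum)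
  then show ?thesis by (simp add: taylor_def pcompose_mult)
qed

lemma taylor_0 [simp]: "taylor p 0 = 0"
  by (simp add: taylor_def)

lemma taylor_const [simp]: "taylor p (const2 c) = const2 c"
  by (simp add: taylor_def map_poly_pCons pcompose_pCons)

lemma taylor_1 [simp]: "taylor p 1 = 1"
  using taylor_const[of p 1] by (simp add: one_pCons)

lemma taylor_power [simp]: "taylor p (f ^ n) = taylor p f ^ n"
  by (induction n) auto

definition linx :: "complex \<Rightarrow> complex poly poly" where "linx u = [:[:- u, 1:]:]"
definition liny :: "complex \<Rightarrow> complex poly poly" where "liny v = [:[:- v:], 1:]"

lemma linx_altdef: "linx u = mon 1 0 - const2 u * mon 0 0"
  and liny_altdef: "liny v = mon 0 1 - const2 v * mon 0 0"
  by (simp_all add: linx_def liny_def mon_def monom_altdef one_pCons)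

lemma linx_in_box: "linx u \<in> box 1"
  and liny_in_box: "liny u \<in> box 1"
  unfolding linx_altdef liny_altdef by (intro box_diff box_const_mult mon_in_box[THEN iffD2]; simp)+

lemma taylor_linx: "taylor (u, v) (linx u') = mon 1 0 + const2 (u - u')"
  by (simp add: taylor_def linx_def map_poly_pCons pcompose_pCons mon_def monom_altdef)

lemma taylor_liny: "taylor (u, v) (liny v') = mon 0 1 + const2 (v - v')"
  by (simp add: taylor_def liny_def map_poly_pCons pcompose_pCons mon_def monom_altdef one_pCons)

lemma eval2_linx [simp]: "eval2 p (linx u) = fst p - u"
  and eval2_liny [simp]: "eval2 p (liny u) = snd p - u"
  by (simp_all add: eval2_def linx_def liny_def)

lemma coeff2_taylor_0: "coeff2 (taylor p h) 0 0 = eval2 p h"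
proof -
  have [simp]: "coeff (pcompose a b) 0 = poly a (coeff b 0)" for a b :: "'a::comm_ring_1 poly"
    by (simp add: pcompose_coeff_0)
  have "poly (poly (map_poly (\<lambda>q. pcompose q [:fst p, 1:]) h) [:snd p:]) 0
      = poly (poly h [:snd p:]) (fst p)"
    by (induction h) (auto simp: map_poly_pCons poly_pcompose)
  then show ?thesis by (simp add: taylor_def eval2_def poly_0_coeff_0)
qed

definition vanish :: "nat \<Rightarrow> complex \<times> complex \<Rightarrow> complex poly poly \<Rightarrow> bool" where
  "vanish m p h \<longleftrightarrow> (\<forall>i j. i + j < m \<longrightarrow> coeff2 (taylor p h) i j = 0)"

lemma vanish_add: "vanish m p f \<Longrightarrow> vanish m p g \<Longrightarrow> vanish m p (f + g)"
  by (simp add: vanish_def)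

lemma vanish_0 [simp]: "vanish 0 p f"
  by (simp add: vanish_def)

lemma vanish_1: "vanish 1 p f \<longleftrightarrow> eval2 p f = 0"
  by (simp add: vanish_def flip: coeff2_taylor_0)

text \<open>If \<open>i + j < a + b\<close>, every splitting of the exponents leaves total order
  below \<open>a\<close> in the first factor or below \<open>b\<close> in the second.\<close>

lemma vanish_mult:
  assumes "vanish a p f" "vanish b p g"
  shows "vanish (a + b) p (f * g)"
  unfolding vanish_def
proof (intro allI impI)
  fix i j :: nat assume ij: "i + j < a + b"
  have "coeff2 (taylor p f) i' j' * coeff2 (taylor p g) (i - i') (j - j') = 0"
    if "i' \<le> i" "j' \<le> j" for i' j'
  proof (cases "i' + j' < a")
    case True then show ?thesis using assms by (simp add: vanish_def)
  next
    case False
    then have "(i - i') + (j - j') < b" using ij that by linarith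
    then show ?thesis using assms by (simp add: vanish_def)
  qed
  then show "coeff2 (taylor p (f * g)) i j = 0"
    unfolding taylor_mult coeff2_mult by (simp add: sum.neutral)
qed

lemma vanish_power: "vanish a p f \<Longrightarrow> vanish (a * n) p (f ^ n)"
  by (induction n) (auto intro: vanish_mult)

section \<open>Linear algebra with polynomials of bounded bi-degree\<close>

interpretation poly2: vector_space "\<lambda>c (h :: complex poly poly). const2 c * h"
proof
  show "const2 (a + b) * h = const2 a * h + const2 b * h" for a b and h :: "complex poly poly"
    by (rule poly2_eqI) (simp add: algebra_simps)
qed (auto intro!: poly2_eqI simp: algebra_simps)

text \<open>The set \<open>E\<close> extends the family to a maximal independent subset of
  \<open>box N\<close>, whose size is bounded by the number of monomials. Independence of the
  indexed family also rules out repetitions among the \<open>b j\<close>.\<close>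

lemma box_spanned_by_complement:
  assumes J: "finite J" and b: "\<And>j. j \<in> J \<Longrightarrow> b j \<in> box N"
    and indep: "\<And>c. (\<Sum>j\<in>J. const2 (c j) * b j) = 0 \<Longrightarrow> \<forall>j\<in>J. c j = 0"
  shows "\<exists>E. finite E \<and> card E + card J \<le> (N + 1)\<^sup>2 \<and> box N \<subseteq> poly2.span (E \<union> b ` J)"
proof -
  have inj: "inj_on b J"
  proof (rule inj_onI, rule ccontr)
    fix i j assume ij: "i \<in> J" "j \<in> J" "b i = b j" "i \<noteq> j"
    have "(\<Sum>l\<in>J. const2 (if l = i then 1 else if l = j then - 1 else 0) * b l)
        = (\<Sum>l\<in>{i, j}. const2 (if l = i then 1 else if l = j then - 1 else 0) * b l)"
      using ij J by (intro sum.mono_neutral_right) auto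
    also have "\<dots> = 0" using ij by (simp flip: smult_add_left)
    finally show False
      using indep[of "\<lambda>l. if l = i then 1 else if l = j then - 1 else 0"] ij by auto
  qed
  have ind: "\<not> poly2.dependent (b ` J)"
  proof
    assume "poly2.dependent (b ` J)"
    then obtain u where u: "\<exists>v\<in>b ` J. u v \<noteq> 0" "(\<Sum>v\<in>b ` J. const2 (u v) * v) = 0"
      using poly2.dependent_finite[of "b ` J"] J by auto
    have "(\<Sum>j\<in>J. const2 (u (b j)) * b j) = 0"
      using u(2) by (simp add: sum.reindex[OF inj])
    with indep[of "u \<circ> b"] u(1) show False by auto
  qed
  obtain B where B: "b ` J \<subseteq> B" "B \<subseteq> box N" "\<not> poly2.dependent B" "box N \<subseteq> poly2.span B"
    using poly2.maximal_independent_subset_extend[OF _ ind, of "box N"] b by blast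
  define T where "T = (\<lambda>t. mon (fst t) (snd t)) ` ({..N} \<times> {..N})"
  have T: "finite T" "card T \<le> (N + 1)\<^sup>2"
    using card_image_le[of "{..N} \<times> {..N}"] by (auto simp: T_def power2_eq_square)
  have "box N \<subseteq> poly2.span T"
  proof
    fix h assume "h \<in> box N"
    from box_expansion[OF this] show "h \<in> poly2.span T"
      by (metis (no_types, lifting) T_def imageI poly2.span_base poly2.span_scale poly2.span_sum)
  qed
  then have finB: "finite B" "card B \<le> card T"
    using poly2.independent_span_bound[OF T(1) B(3)] B(2) by auto
  have "card (B - b ` J) + card J = card B"
    using B(1) finB(1) by (metis J card_Diff_subset card_image card_mono finite_imageI inj le_add_diff_inverse2)
  moreover have "B - b ` J \<union> b ` J = B" using B(1) by auto
  ultimately show ?thesis using finB T B(4) by (intro exI[of _ "B - b ` J"]) auto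
qed

lemma coeff2_mult_mon:
  "coeff2 (h * mon i j) i' j' = (if i \<le> i' \<and> j \<le> j' then coeff2 h (i' - i) (j' - j) else 0)"
  unfolding mon_def by (subst mult.commute) (auto simp: coeff_monom_mult)

text \<open>The corner monomial leads \<open>f\<close> for the order by degree in y, then in x, and
  leading terms multiply.\<close>

lemma coeff2_top_mult:
  assumes "f \<in> box k" "coeff2 f k k \<noteq> 0"
  shows "coeff2 (f * q) (k + degree (lead_coeff q)) (k + degree q) = coeff2 f k k * lead_coeff (lead_coeff q)"
proof -
  have "degree f = k"
    using assms by (intro antisym degree_le le_degree) (fastforce simp: box_def poly_eq_iff)+
  moreover have "degree (coeff f k) = k"
    using assms by (intro antisym degree_le le_degree) (fastforce simp: box_def)+
  ultimately show ?thesis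
    by (metis coeff_mult_degree_sum)
qed

text \<open>In a relation \<open>f * h1 + g * h2 = 0\<close>, coprimality makes \<open>h2\<close> a multiple of \<open>f\<close>, so the
  leading monomial of \<open>h2\<close> is divisible by the corner monomial of \<open>f\<close>. Hence omitting those monomials
  from the multipliers of \<open>g\<close> leaves linearly independent multiples of \<open>f\<close> and \<open>g\<close>.\<close>

lemma complement_of_coprime_pair:
  assumes f: "f \<in> box k" "coeff2 f k k \<noteq> 0" and g: "g \<in> box d" "g \<noteq> 0"
    and cop: "coprime f g" and N: "N \<ge> k + d"
  obtains E where "finite E" "card E \<le> 2 * k * d"
    "box N \<subseteq> poly2.span (E \<union> {f * h | h. True} \<union> {g * h | h. True})"
proof -
  define A where "A = {..N - k} \<times> {..N - k}"
  define S where "S = {..N - d} \<times> {..N - d} - {k..N - d} \<times> {k..N - d}"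
  have fin: "finite A" "finite S" by (auto simp: A_def S_def)
  define b where "b = case_sum (\<lambda>t. f * mon (fst t) (snd t)) (\<lambda>t. g * mon (fst t) (snd t))"
  have f0: "f \<noteq> 0" using f by auto
  have "\<exists>E. finite E \<and> card E + card (A <+> S) \<le> (N + 1)\<^sup>2 \<and> box N \<subseteq> poly2.span (E \<union> b ` (A <+> S))"
  proof (rule box_spanned_by_complement)
    show "finite (A <+> S)" using fin by simp
    show "b j \<in> box N" if "j \<in> A <+> S" for j
    proof -
      have "f * mon (fst t) (snd t) \<in> box N" if "t \<in> A" for t
        using box_mult[OF f(1), of "mon (fst t) (snd t)" "N - k"] that N by (auto simp: A_def)
      moreover have "g * mon (fst t) (snd t) \<in> box N" if "t \<in> S" for t
        using box_mult[OF g(1), of "mon (fst t) (snd t)" "N - d"] that N by (auto simp: S_def)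
      ultimately show ?thesis using that by (auto simp: b_def)
    qed
  next
    fix c assume c: "(\<Sum>j\<in>A <+> S. const2 (c j) * b j) = 0"
    define h1 where "h1 = (\<Sum>t\<in>A. const2 (c (Inl t)) * mon (fst t) (snd t))"
    define h2 where "h2 = (\<Sum>t\<in>S. const2 (c (Inr t)) * mon (fst t) (snd t))"
    have "f * h1 + g * h2 = (\<Sum>j\<in>A <+> S. const2 (c j) * b j)"
      using fin by (simp add: sum.Plus b_def h1_def h2_def sum_distrib_left mult.left_commute del: mult_pCons_left)
    with c have eq: "f * h1 + g * h2 = 0" by simp
    then have "f dvd g * h2" by (metis add.commute dvd_add_right_iff dvd_0_right dvd_triv_left)
    then have "f dvd h2" using cop by (simp add: coprime_dvd_mult_right_iff)
    then obtain q where q: "h2 = f * q" by blast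
    have h2: "h2 = 0"
    proof (rule ccontr)
      assume "h2 \<noteq> 0"
      then have "coeff2 h2 (k + degree (lead_coeff q)) (k + degree q) \<noteq> 0"
        using coeff2_top_mult[OF f, of q] f q by auto
      then have "(k + degree (lead_coeff q), k + degree q) \<in> S"
        unfolding h2_def by (subst (asm) sum_mon[OF fin(2)]) (metis (full_types))
      then show False by (auto simp: S_def)
    qed
    with eq f0 have h1: "h1 = 0" by simp
    have "c (Inl t) = 0" if "t \<in> A" for t
      using sum_mon[OF fin(1), of "\<lambda>t. c (Inl t)" "snd t" "fst t"] that h1 unfolding h1_def by simp
    moreover have "c (Inr t) = 0" if "t \<in> S" for t
      using sum_mon[OF fin(2), of "\<lambda>t. c (Inr t)" "snd t" "fst t"] that h2 unfolding h2_def by simp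
    ultimately show "\<forall>j\<in>A <+> S. c j = 0" by auto
  qed
  then obtain E where E: "finite E" "card E + card (A <+> S) \<le> (N + 1)\<^sup>2"
    "box N \<subseteq> poly2.span (E \<union> b ` (A <+> S))" by blast
  \<comment> \<open>This form of \<open>N\<close> removes truncated subtraction. With
    \<open>a = M + 1\<close> the count is the identity \<open>(a + k + d)\<^sup>2 + a\<^sup>2 - (a +
    k)\<^sup>2 - (a + d)\<^sup>2 = 2 * k * d\<close>.\<close>
  obtain M where M: "N = M + k + d" using N by (metis add.commute add.left_commute le_Suc_ex)
  have "card S = (M + k + 1)\<^sup>2 - (M + 1)\<^sup>2"
    unfolding S_def by (subst card_Diff_subset) (auto simp: M power2_eq_square)
  moreover have "(M + 1)\<^sup>2 \<le> (M + k + 1)\<^sup>2" by (intro power_mono) auto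
  moreover have "card A = (M + d + 1)\<^sup>2" by (simp add: A_def M power2_eq_square)
  moreover have "card (A <+> S) = card A + card S" using fin by (rule card_Plus)
  ultimately have "card E + (M + d + 1)\<^sup>2 + (M + k + 1)\<^sup>2 \<le> (M + k + d + 1)\<^sup>2 + (M + 1)\<^sup>2"
    using E(2)[unfolded M] by linarith
  then have "card E \<le> 2 * k * d"
    by (simp add: power2_eq_square algebra_simps)
  moreover have "b ` (A <+> S) \<subseteq> {f * h | h. True} \<union> {g * h | h. True}"
    by (auto simp: b_def)
  then have "poly2.span (E \<union> b ` (A <+> S)) \<subseteq> poly2.span (E \<union> {f * h | h. True} \<union> {g * h | h. True})"
    by (intro poly2.span_mono) blast
  ultimately show ?thesis using that[OF E(1)] E(3) by blast
qed

text \<open>A pencil argument: if \<open>K\<close> divides two members of the pencil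
  \<open>g + const2 c * h\<close>, it divides their difference, hence both \<open>h\<close> and
  \<open>g\<close>, which the choice of \<open>g\<close> and \<open>h\<close> excludes. So each
  \<open>K\<close> spoils only finitely many \<open>c\<close>.\<close>

lemma exists_avoiding_divisors:
  fixes G :: "complex poly poly set"
  assumes "finite Q" "G \<noteq> {}"
    and closed: "\<And>g h c. g \<in> G \<Longrightarrow> h \<in> G \<Longrightarrow> g + const2 c * h \<in> G"
    and "\<And>H. H \<in> Q \<Longrightarrow> \<exists>g\<in>G. \<not> H dvd g"
  shows "\<exists>g\<in>G. \<forall>H\<in>Q. \<not> H dvd g"
  using assms(1,4)
proof (induction Q rule: finite_induct)
  case empty then show ?case using assms(2) by auto
next
  case (insert H Q)
  then obtain g where g: "g \<in> G" "\<forall>H\<in>Q. \<not> H dvd g" by auto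
  obtain h where h: "h \<in> G" "\<not> H dvd h" using insert.prems by blast
  define bad where "bad K = {c. K dvd g + const2 c * h}" for K
  have "finite (bad K)" if "K \<in> insert H Q" for K
  proof (rule ccontr)
    assume inf: "infinite (bad K)"
    then obtain c where c: "c \<in> bad K" by (metis ex_in_conv finite.emptyI)
    obtain c' where c': "c' \<in> bad K" "c' \<noteq> c"
      using inf by (metis finite.simps finite_subset insertI1 subsetI insert_iff)
    have "K dvd (g + const2 c * h) - (g + const2 c' * h)"
      using c c' unfolding bad_def by (intro dvd_diff) auto
    also have "(g + const2 c * h) - (g + const2 c' * h) = const2 (c - c') * h"
      by (rule poly2_eqI) (simp add: algebra_simps)
    finally have "K dvd const2 (inverse (c - c')) * (const2 (c - c') * h)" by (rule dvd_mult)
    also have "\<dots> = h" using c' by (intro poly2_eqI) simp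
    finally have *: "K dvd h" .
    then have "K dvd g" using c unfolding bad_def
      by (metis dvd_add_left_iff dvd_mult mem_Collect_eq)
    with * show False using that g h by auto
  qed
  then have "finite (\<Union>K\<in>insert H Q. bad K)" using insert.hyps by blast
  then obtain c where "c \<notin> (\<Union>K\<in>insert H Q. bad K)"
    using ex_new_if_finite infinite_UNIV_char_0 by blast
  then show ?case using closed[OF g(1) h(1), of c] by (intro bexI[of _ "g + const2 c * h"]) (auto simp: bad_def)
qed

section \<open>A Bezout inequality with multiplicities\<close>

definition jets :: "nat \<Rightarrow> (nat \<times> nat) set" where
  "jets m = {(i, j). i + j < m}"

lemma finite_jets [simp]: "finite (jets m)"
  by (rule finite_subset[of _ "{..m} \<times> {..m}"]) (auto simp: jets_def)

lemma card_jets_Suc: "card (jets (Suc m)) = card (jets m) + Suc m"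
proof -
  have "jets (Suc m) = jets m \<union> (\<lambda>i. (i, m - i)) ` {..m}"
    by (auto simp: jets_def image_iff)
  moreover have "jets m \<inter> (\<lambda>i. (i, m - i)) ` {..m} = {}"
    by (auto simp: jets_def)
  moreover have "card ((\<lambda>i. (i, m - i)) ` {..m}) = Suc m"
    by (subst card_image) (auto intro: inj_onI)
  ultimately show ?thesis by (simp add: card_Un_disjoint)
qed

text \<open>Multiplication by a polynomial vanishing at \<open>p\<close> lowers the order of a jet functional at \<open>p\<close>.\<close>

lemma coeff2_taylor_mult_vanishing:
  assumes "eval2 p g = 0" "i + j \<le> m"
  shows "coeff2 (taylor p (g * h)) i j =
    (\<Sum>s\<in>jets m. coeff2 (taylor p h) (fst s) (snd s) *
       (if fst s \<le> i \<and> snd s \<le> j then coeff2 (taylor p g) (i - fst s) (j - snd s) else 0))"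
proof -
  let ?F = "\<lambda>s. coeff2 (taylor p h) (fst s) (snd s) * coeff2 (taylor p g) (i - fst s) (j - snd s)"
  have "coeff2 (taylor p (g * h)) i j = (\<Sum>j'\<le>j. \<Sum>i'\<le>i. ?F (i', j'))"
    by (simp only: mult.commute[of g h] taylor_mult coeff2_mult fst_conv snd_conv)
  also have "\<dots> = sum ?F ({..i} \<times> {..j})"
    by (subst sum.swap) (simp add: sum.cartesian_product case_prod_unfold)
  also have "\<dots> = (\<Sum>s\<in>jets m. if fst s \<le> i \<and> snd s \<le> j then ?F s else 0)"
    unfolding sum.inter_filter[OF finite_jets, symmetric]
  proof (rule sum.mono_neutral_cong_right)
    show "\<forall>s\<in>{..i} \<times> {..j} - {s \<in> jets m. fst s \<le> i \<and> snd s \<le> j}. ?F s = 0"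
    proof
      fix s assume "s \<in> {..i} \<times> {..j} - {s \<in> jets m. fst s \<le> i \<and> snd s \<le> j}"
      \<comment> \<open>Only the pair (i, j) can have order \<open>m\<close>, and its cofactor is
        the value of \<open>g\<close> at \<open>p\<close>.\<close>
      then have "s = (i, j)" using assms(2) by (auto simp: jets_def)
      then show "?F s = 0" using assms(1) by (simp add: coeff2_taylor_0)
    qed
  qed (auto simp: jets_def)
  also have "\<dots> = (\<Sum>s\<in>jets m. coeff2 (taylor p h) (fst s) (snd s) *
       (if fst s \<le> i \<and> snd s \<le> j then coeff2 (taylor p g) (i - fst s) (j - snd s) else 0))"
    by (intro sum.cong) auto
  finally show ?thesis .
qed

text \<open>If the bound failed, some non-zero combination \<open>L\<close> of jet functionals of order below \<open>m\<close> would
  vanish on all multiples of \<open>g\<close> and on the complement \<open>E\<close>. It vanishes on all multiples of \<open>f\<close>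
  anyway, hence on \<open>box N\<close>, although jets at distinct points are independent there.\<close>

lemma mult_bezout:
  assumes W: "finite W" and f: "f \<in> box k" "coeff2 f k k \<noteq> 0" and g: "g \<in> box d" "g \<noteq> 0"
    and cop: "coprime f g"
    and fW: "\<And>p. p \<in> W \<Longrightarrow> vanish m p f" and gW: "\<And>p. p \<in> W \<Longrightarrow> eval2 p g = 0"
  shows "m * card W \<le> 2 * k * d"
proof (rule ccontr)
  assume contra: "\<not> ?thesis"
  then obtain n where m: "m = Suc n" by (cases m) auto
  \<comment> \<open>Large enough for the complement of the multiples of \<open>f\<close> and
    \<open>g\<close>, and for the test polynomial \<open>h\<close> below: one \<open>m\<close>-th
    power of a linear factor per further point, and \<open>i + j < m\<close> linear factors at
    \<open>p\<close>.\<close>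
  define N where "N = (card W + 2) * m + k + d"
  obtain E where E: "finite E" "card E \<le> 2 * k * d"
    "box N \<subseteq> poly2.span (E \<union> {f * h | h. True} \<union> {g * h | h. True})"
    using complement_of_coprime_pair[OF f g cop, of N] by (auto simp: N_def)
  \<comment> \<open>The unknowns, indexed by \<open>T\<close>, are the coefficients of
    \<open>L\<close>. The conditions, indexed by \<open>C\<close>, say that \<open>L\<close> kills
    \<open>E\<close> and that in \<open>L (g * h)\<close> the coefficient of each jet of
    \<open>h\<close> of order below \<open>n\<close> is zero.\<close>
  define T where "T = W \<times> jets m"
  define C where "C = E <+> (W \<times> jets n)"
  define M where "M = case_sum (\<lambda>e (p, i, j). coeff2 (taylor p e) i j)
    (\<lambda>(q, s) (p, i, j). if q = p \<and> fst s \<le> i \<and> snd s \<le> j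
       then coeff2 (taylor p g) (i - fst s) (j - snd s) else 0)"
  have fin: "finite T" "finite C" using W E by (auto simp: T_def C_def)
  have "card C = card E + card W * card (jets n)"
    using E W by (simp add: C_def card_Plus card_cartesian_product)
  \<comment> \<open>The surplus of \<open>T\<close> over the jets of order below \<open>n\<close> is
    \<open>m * card W\<close>, assumed to exceed \<open>2 * k * d\<close>.\<close>
  also have "\<dots> < card T"
    using contra E(2) by (simp add: T_def card_cartesian_product m card_jets_Suc algebra_simps)
  finally obtain c where c: "\<exists>t\<in>T. c t \<noteq> 0" "\<And>e. e \<in> C \<Longrightarrow> (\<Sum>t\<in>T. c t * M e t) = 0"
    using homogeneous_system_nontrivial[OF fin(2,1)] by metis
  define L where "L h = (\<Sum>(p, i, j)\<in>T. c (p, i, j) * coeff2 (taylor p h) i j)" for h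
  have L_add: "L (a + b) = L a + L b" for a b
    by (simp add: L_def case_prod_unfold sum.distrib algebra_simps)
  have L_scale: "L (const2 r * b) = r * L b" for r b
    unfolding L_def taylor_mult taylor_const coeff2_const_mult
    by (simp add: case_prod_unfold sum_distrib_left algebra_simps)
  have LE: "L e = 0" if "e \<in> E" for e
    using c(2)[of "Inl e"] that by (simp add: InlI C_def M_def L_def case_prod_unfold)
  have Lf: "L (f * h) = 0" for h
    unfolding L_def
  proof (rule sum.neutral, clarify)
    fix p i j assume "(p, i, j) \<in> T"
    then have "p \<in> W" and ij: "i + j < m" by (auto simp: T_def jets_def)
    then have "vanish (m + 0) p (f * h)" by (intro vanish_mult fW vanish_0)
    with ij show "c (p, i, j) * coeff2 (taylor p (f * h)) i j = 0" by (simp add: vanish_def)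
  qed
  have Lg: "L (g * h) = 0" for h
  proof -
    have eq: "coeff2 (taylor p (g * h)) i j =
        (\<Sum>s\<in>W \<times> jets n. coeff2 (taylor (fst s) h) (fst (snd s)) (snd (snd s)) * M (Inr s) (p, i, j))"
      if "(p, i, j) \<in> T" for p i j
    proof -
      have p: "p \<in> W" and ij: "i + j \<le> n" using that by (auto simp: T_def jets_def m)
      have "(\<Sum>s\<in>W \<times> jets n. coeff2 (taylor (fst s) h) (fst (snd s)) (snd (snd s)) * M (Inr s) (p, i, j))
        = (\<Sum>q\<in>W. if q = p then (\<Sum>s\<in>jets n. coeff2 (taylor p h) (fst s) (snd s) *
            (if fst s \<le> i \<and> snd s \<le> j then coeff2 (taylor p g) (i - fst s) (j - snd s) else 0)) else 0)"
        unfolding sum.cartesian_product'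
        by (auto intro!: sum.cong sum.neutral simp: M_def)
      then show ?thesis
        using coeff2_taylor_mult_vanishing[OF gW[OF p] ij, of h] p W by simp
    qed
    have "L (g * h) = (\<Sum>t\<in>T. c t * (\<Sum>s\<in>W \<times> jets n.
        coeff2 (taylor (fst s) h) (fst (snd s)) (snd (snd s)) * M (Inr s) t))"
      unfolding L_def by (rule sum.cong) (auto simp: eq simp del: taylor_mult)
    also have "\<dots> = (\<Sum>s\<in>W \<times> jets n. coeff2 (taylor (fst s) h) (fst (snd s)) (snd (snd s)) *
        (\<Sum>t\<in>T. c t * M (Inr s) t))"
      unfolding sum_distrib_left by (subst sum.swap) (simp add: algebra_simps)
    also have "\<dots> = 0"
      by (rule sum.neutral) (auto simp: c(2) C_def InrI)
    finally show ?thesis .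
  qed
  have L_box: "L h = 0" if "h \<in> box N" for h
  proof -
    have "h \<in> poly2.span (E \<union> {f * h | h. True} \<union> {g * h | h. True})" using E(3) that by blast
    then show ?thesis
    proof (induction rule: poly2.span_induct_alt)
      case base
      show ?case using L_scale[of 0 0] by simp
    next
      case (step r x y)
      then show ?case by (auto simp: L_add L_scale LE Lf Lg simp del: mult_pCons_left)
    qed
  qed
  \<comment> \<open>A jet (i, j) at \<open>p\<close> of maximal order with non-zero coefficient is
    isolated: \<open>h\<close> kills all jets below order \<open>m\<close> at other points, and at
    \<open>p\<close> all of order at most \<open>i + j\<close> except (i, j) itself.\<close>
  define Z where "Z = {t \<in> T. c t \<noteq> 0}"
  have Z: "finite Z" "Z \<noteq> {}" using fin c(1) by (auto simp: Z_def)
  let ?w = "\<lambda>t :: (complex \<times> complex) \<times> nat \<times> nat. fst (snd t) + snd (snd t)"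
  have "Max (?w ` Z) \<in> ?w ` Z" using Z by (intro Max_in) auto
  then obtain p i j where t: "(p, i, j) \<in> Z" "Max (?w ` Z) = i + j" by auto
  have max: "i' + j' \<le> i + j" if "(q, i', j') \<in> Z" for q i' j'
    using Max_ge[of "?w ` Z" "i' + j'"] Z(1) that t(2) by force
  \<comment> \<open>A vertical or horizontal line through \<open>q\<close> that misses
    \<open>p\<close>; distinct points differ in some coordinate.\<close>
  define l where "l q = (if fst q \<noteq> fst p then linx (fst q) else liny (snd q))" for q
  define U where "U = (\<Prod>q\<in>W - {p}. l q ^ m)"
  define h where "h = U * linx (fst p) ^ i * liny (snd p) ^ j"
  have l_p: "eval2 p (l q) \<noteq> 0" if "q \<noteq> p" for q
    using that by (auto simp: l_def prod_eq_iff)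
  have l_q: "vanish m q (l q ^ m)" for q
    using vanish_power[of 1 q "l q" m] by (simp add: vanish_1 l_def del: One_nat_def)
  have h_q: "vanish m q h" if "q \<in> W" "q \<noteq> p" for q
  proof -
    have "U = l q ^ m * (\<Prod>q\<in>W - {p} - {q}. l q ^ m)"
      unfolding U_def using that W by (intro prod.remove) auto
    moreover have "vanish (m + 0) q \<dots>" by (intro vanish_mult l_q vanish_0)
    ultimately have "vanish m q U" by simp
    then have "vanish (m + 0) q h" unfolding h_def mult.assoc by (intro vanish_mult vanish_0)
    then show ?thesis by simp
  qed
  have taylor_h: "taylor p h = taylor p U * mon i j"
  proof -
    have "mon 1 0 ^ a = mon a 0" "mon 0 1 ^ a = mon 0 a" for a
      by (induction a) (simp_all add: mon_mult)
    then show ?thesis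
      by (cases p) (simp add: h_def taylor_linx taylor_liny mon_mult mult.assoc)
  qed
  have U0: "coeff2 (taylor p U) 0 0 \<noteq> 0"
    unfolding coeff2_taylor_0 U_def eval2_prod eval2_simps using W l_p by auto
  have value_at: "c (q, i', j') * coeff2 (taylor q h) i' j'
      = (if (q, i', j') = (p, i, j) then c (p, i, j) * coeff2 (taylor p U) 0 0 else 0)"
    if "(q, i', j') \<in> T" for q i' j'
  proof (cases "q = p")
    case False
    then show ?thesis using that h_q[of q] by (auto simp: T_def jets_def vanish_def)
  next
    case True
    have "i' + j' \<le> i + j" if "c (q, i', j') \<noteq> 0"
      using max[of q i' j'] that \<open>(q, i', j') \<in> T\<close> by (auto simp: Z_def)
    then show ?thesis using True by (cases "c (q, i', j') = 0") (auto simp: taylor_h coeff2_mult_mon)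
  qed
  have "L h = (\<Sum>t\<in>T. if t = (p, i, j) then c (p, i, j) * coeff2 (taylor p U) 0 0 else 0)"
    unfolding L_def
  proof (rule sum.cong[OF refl])
    fix t assume "t \<in> T"
    moreover obtain q i' j' where "t = (q, i', j')" by (rule prod_cases3)
    ultimately show "(case t of (p, i, j) \<Rightarrow> c (p, i, j) * coeff2 (taylor p h) i j) =
        (if t = (p, i, j) then c (p, i, j) * coeff2 (taylor p U) 0 0 else 0)"
      using value_at by (simp only: prod.case)
  qed
  also have "\<dots> = c (p, i, j) * coeff2 (taylor p U) 0 0"
    using t(1) fin by (simp add: Z_def)
  finally have "L h \<noteq> 0" using t(1) U0 by (simp add: Z_def)
  moreover have "h \<in> box N"
  proof -
    have pow: "a ^ n \<in> box n" if "a \<in> box 1" for a n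
      using that box_mult[of a 1] by (induction n) (auto simp flip: mon_0_0)
    have "(\<Prod>q\<in>V. l q ^ m) \<in> box (card V * m)" if "finite V" for V
      using that
    proof (induction V rule: finite_induct)
      case empty then show ?case by (simp flip: mon_0_0)
    next
      case (insert q V)
      have "l q ^ m \<in> box m" using linx_in_box liny_in_box by (auto simp: l_def intro!: pow)
      from box_mult[OF this insert.IH] insert.hyps show ?case by simp
    qed
    then have "U \<in> box (card (W - {p}) * m)" unfolding U_def using W by blast
    then have "h \<in> box (card (W - {p}) * m + i + j)"
      unfolding h_def by (intro box_mult pow linx_in_box liny_in_box)
    moreover have "card (W - {p}) * m + i + j \<le> N"
    proof -
      have "card (W - {p}) * m \<le> card W * m" using W by (intro mult_right_mono card_mono) auto
      moreover have "i + j < m" using t(1) by (auto simp: Z_def T_def jets_def)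
      moreover have "N = card W * m + 2 * m + k + d" by (simp add: N_def algebra_simps)
      ultimately show ?thesis by linarith
    qed
    ultimately show ?thesis using box_mono by blast
  qed
  ultimately show False using L_box by blast
qed

section \<open>Interpolation and the choice of a coprime polynomial\<close>

lemma exists_box: "\<exists>N. h \<in> box N"
proof -
  define N where "N = (\<Sum>j\<le>degree h. degree (coeff h j)) + degree h"
  have "i \<le> N \<and> j \<le> N" if "coeff2 h i j \<noteq> 0" for i j
  proof -
    from that have j: "j \<le> degree h" by (intro le_degree) auto
    then have "degree (coeff h j) \<le> (\<Sum>j\<le>degree h. degree (coeff h j))"
      by (intro member_le_sum) auto
    with j le_degree[OF that] show ?thesis by (simp add: N_def)
  qed
  then show ?thesis by (auto simp: box_def)
qed

text \<open>Take \<open>W\<close> of least size among the subsets on which only \<open>0\<close> in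
  \<open>box n\<close> vanishes. Removing \<open>p\<close> destroys this property and yields
  \<open>e p\<close>, zero on \<open>W - {p}\<close> but not at \<open>p\<close>; these form a
  Lagrange basis. The size bound holds because evaluation on \<open>W\<close> is injective on a
  space of dimension \<open>(n + 1)\<^sup>2\<close>.\<close>

lemma box_interpolation:
  assumes S: "finite S" "\<And>g. g \<in> box n \<Longrightarrow> (\<And>p. p \<in> S \<Longrightarrow> eval2 p g = 0) \<Longrightarrow> g = 0"
  obtains W where "W \<subseteq> S" "(n + 1)\<^sup>2 \<le> card W"
    "\<And>g. g \<in> box n \<Longrightarrow> (\<And>p. p \<in> W \<Longrightarrow> eval2 p g = 0) \<Longrightarrow> g = 0"
    "\<And>h. \<exists>r\<in>box n. \<forall>p\<in>W. eval2 p (h - r) = 0"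
proof -
  define faithful where
    "faithful W \<longleftrightarrow> (\<forall>g\<in>box n. (\<forall>p\<in>W. eval2 p g = 0) \<longrightarrow> g = 0)" for W
  obtain W where W: "W \<subseteq> S \<and> faithful W" "\<And>V. V \<subseteq> S \<and> faithful V \<Longrightarrow> card W \<le> card V"
    using ex_has_least_nat[of "\<lambda>W. W \<subseteq> S \<and> faithful W" S card] S(2) unfolding faithful_def by blast
  have fin: "finite W" using W S finite_subset by blast
  have "\<exists>g\<in>box n. eval2 p g \<noteq> 0 \<and> (\<forall>q\<in>W - {p}. eval2 q g = 0)" if "p \<in> W" for p
  proof -
    have "card (W - {p}) < card W" using fin that by (rule card_Diff1_less)
    then have "\<not> faithful (W - {p})" using W by (meson Diff_subset not_less order_trans)
    then show ?thesis using W(1) unfolding faithful_def by (metis DiffI singletonD)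
  qed
  then obtain e where e: "\<And>p. p \<in> W \<Longrightarrow> e p \<in> box n" "\<And>p. p \<in> W \<Longrightarrow> eval2 p (e p) \<noteq> 0"
    "\<And>p q. p \<in> W \<Longrightarrow> q \<in> W \<Longrightarrow> q \<noteq> p \<Longrightarrow> eval2 q (e p) = 0" by (metis DiffI singletonD)
  have interp: "\<exists>r\<in>box n. \<forall>p\<in>W. eval2 p (h - r) = 0" for h
  proof (intro bexI ballI)
    let ?r = "\<Sum>p\<in>W. const2 (eval2 p h / eval2 p (e p)) * e p"
    show "?r \<in> box n" using e by (intro box_sum box_const_mult) auto
    fix q assume q: "q \<in> W"
    have "eval2 q ?r = (\<Sum>p\<in>W. if p = q then eval2 q h else 0)"
      unfolding eval2_sum by (intro sum.cong) (use e q in \<open>auto simp del: mult_pCons_left\<close>)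
    then show "eval2 q (h - ?r) = 0" using q fin by simp
  qed
  have "(n + 1)\<^sup>2 \<le> card W"
  proof (rule ccontr)
    assume "\<not> ?thesis"
    then have "card W < card ({..n} \<times> {..n})" by (simp add: power2_eq_square)
    from homogeneous_system_nontrivial[OF fin _ this, of "\<lambda>p t. eval2 p (mon (fst t) (snd t))"]
    obtain c where c: "\<exists>t\<in>{..n} \<times> {..n}. c t \<noteq> 0"
      "\<And>p. p \<in> W \<Longrightarrow> (\<Sum>t\<in>{..n} \<times> {..n}. c t * eval2 p (mon (fst t) (snd t))) = 0" by auto
    let ?g = "\<Sum>t\<in>{..n} \<times> {..n}. const2 (c t) * mon (fst t) (snd t)"
    have "?g \<in> box n" by (intro box_sum box_const_mult) auto
    moreover have "\<forall>p\<in>W. eval2 p ?g = 0" using c(2) by (simp del: mult_pCons_left)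
    ultimately have "?g = 0" using W(1) by (auto simp: faithful_def)
    then have "c t = 0" if "t \<in> {..n} \<times> {..n}" for t
      using sum_mon[of "{..n} \<times> {..n}" c "snd t" "fst t"] that by simp
    then show False using c(1) by blast
  qed
  then show ?thesis using that W(1) interp unfolding faithful_def by metis
qed

text \<open>Every polynomial is congruent modulo the common divisor \<open>H\<close> to an interpolant from
  \<open>box n\<close>, because such representatives persist under multiplication by \<open>x\<close> and \<open>y\<close>. Hence
  \<open>H\<close> divides everything that vanishes on \<open>W\<close>, in particular a polynomial in \<open>x\<close> alone and a
  polynomial in \<open>y\<close> alone.\<close>

lemma common_divisor_is_unit:
  assumes W: "finite W"
    and faithful: "\<And>g. g \<in> box n \<Longrightarrow> (\<And>p. p \<in> W \<Longrightarrow> eval2 p g = 0) \<Longrightarrow> g = 0"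
    and interp: "\<And>h. \<exists>r\<in>box n. \<forall>p\<in>W. eval2 p (h - r) = 0"
    and H: "\<And>g. g \<in> box (n + 1) \<Longrightarrow> (\<And>p. p \<in> W \<Longrightarrow> eval2 p g = 0) \<Longrightarrow> H dvd g"
  shows "H dvd 1"
proof -
  define C where "C = {h. \<exists>r\<in>box n. H dvd h - r \<and> (\<forall>p\<in>W. eval2 p (h - r) = 0)}"
  have C_add: "a + b \<in> C" if "a \<in> C" "b \<in> C" for a b
  proof -
    from that(1) obtain r where "r \<in> box n" "H dvd a - r" "\<forall>p\<in>W. eval2 p (a - r) = 0"
      unfolding C_def by blast
    moreover from that(2) obtain s where "s \<in> box n" "H dvd b - s" "\<forall>p\<in>W. eval2 p (b - s) = 0"
      unfolding C_def by blast
    moreover from calculation have "H dvd (a - r) + (b - s)" by (intro dvd_add)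
    moreover have "(a - r) + (b - s) = a + b - (r + s)" by simp
    ultimately show ?thesis unfolding C_def
      by (intro CollectI bexI[of _ "r + s"]) (auto intro: box_add)
  qed
  have C_scale: "const2 c * a \<in> C" if "a \<in> C" for a c
  proof -
    from that obtain r where "r \<in> box n" "H dvd a - r" "\<forall>p\<in>W. eval2 p (a - r) = 0"
      unfolding C_def by blast
    moreover from this have "H dvd const2 c * (a - r)" by (intro dvd_mult)
    ultimately show ?thesis unfolding C_def
      by (intro CollectI bexI[of _ "const2 c * r"])
         (auto intro: box_const_mult simp: right_diff_distrib simp del: mult_pCons_left)
  qed
  have C_mult: "z * a \<in> C" if "a \<in> C" "z \<in> box 1" for a z
  proof -
    from that(1) obtain r where r: "r \<in> box n" "H dvd a - r" "\<forall>p\<in>W. eval2 p (a - r) = 0"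
      unfolding C_def by blast
    obtain s where s: "s \<in> box n" "\<forall>p\<in>W. eval2 p (z * r - s) = 0" using interp by blast
    \<comment> \<open>Multiplying by a coordinate raises the bi-degree by one, hence
      \<open>box (n + 1)\<close> in the assumption on \<open>H\<close>.\<close>
    have "z * r - s \<in> box (n + 1)"
      using box_mult[OF that(2) r(1)] s(1) box_mono[of n "n + 1"] by (intro box_diff) (auto simp: add.commute)
    then have "H dvd z * r - s" using s(2) by (intro H) auto
    then have "H dvd z * (a - r) + (z * r - s)" using r(2) by (intro dvd_add dvd_mult)
    moreover have "z * (a - r) + (z * r - s) = z * a - s" by (simp add: algebra_simps)
    moreover have "eval2 p (z * a - s) = 0" if "p \<in> W" for p
      using r(3) s(2) that by simp
    ultimately show ?thesis using s(1) by (auto simp: C_def)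
  qed
  have mon_C: "mon i j \<in> C" for i j
  proof (induction i)
    case 0
    show ?case
    proof (induction j)
      case 0
      show ?case unfolding C_def by (intro CollectI bexI[of _ "mon 0 0"]) (auto simp del: mon_0_0)
    next
      case (Suc j)
      from C_mult[OF this, of "mon 0 1"] show ?case by (simp add: mon_mult)
    qed
  next
    case (Suc i)
    from C_mult[OF this, of "mon 1 0"] show ?case by (simp add: mon_mult)
  qed
  have C_0: "0 \<in> C" using C_scale[OF mon_C, of 0] by simp
  have C_UNIV: "h \<in> C" for h
  proof -
    obtain N where "h \<in> box N" using exists_box by blast
    have sum_C: "(\<Sum>t\<in>V. const2 (coeff2 h (fst t) (snd t)) * mon (fst t) (snd t)) \<in> C" for V
      by (induction V rule: infinite_finite_induct)
         (auto intro: C_add C_scale mon_C C_0 simp del: mult_pCons_left)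
    show ?thesis by (subst box_expansion[OF \<open>h \<in> box N\<close>]) (rule sum_C)
  qed
  have H_dvd: "H dvd h" if "\<And>p. p \<in> W \<Longrightarrow> eval2 p h = 0" for h
  proof -
    obtain r where r: "r \<in> box n" "H dvd h - r" "\<forall>p\<in>W. eval2 p (h - r) = 0"
      using C_UNIV[of h] unfolding C_def by blast
    then have "r = 0" using that by (intro faithful) auto
    with r show ?thesis by simp
  qed
  have "H dvd (\<Prod>p\<in>W. linx (fst p))" using W by (intro H_dvd) auto
  moreover have "(\<Prod>p\<in>W. linx (fst p)) = [:\<Prod>p\<in>W. [:- fst p, 1:]:]"
    by (induction W rule: infinite_finite_induct) (auto simp: linx_def one_pCons)
  moreover have "(\<Prod>p\<in>W. [:- fst p, 1:]) \<noteq> 0" using W by simp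
  ultimately have "degree H \<le> degree [:\<Prod>p\<in>W. [:- fst p, 1:]:]"
    by (intro dvd_imp_degree_le) (simp_all only: pCons_eq_0_iff simp_thms)
  then have "degree H = 0" by simp
  then obtain c where c: "H = [:c:]" by (rule degree_eq_zeroE)
  have "H dvd (\<Prod>p\<in>W. liny (snd p))" using W by (intro H_dvd) auto
  \<comment> \<open>Now \<open>H\<close> is a polynomial \<open>c\<close> in x alone dividing a
    product that is monic in y, so \<open>c\<close> is a unit.\<close>
  then have "c dvd lead_coeff (\<Prod>p\<in>W. liny (snd p))"
    by (simp add: c const_poly_dvd_iff)
  also have "\<dots> = 1" by (simp add: lead_coeff_prod liny_def)
  finally show ?thesis by (simp add: c is_unit_const_poly_iff)
qed

text \<open>A prime factor of \<open>f\<close> dividing all candidates would be a unit by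
  \<open>common_divisor_is_unit\<close>. So each prime factor is avoided by some candidate, and the
  pencil argument avoids all of them at once.\<close>

lemma exists_coprime_vanishing:
  assumes W: "finite W" "W \<noteq> {}"
    and faithful: "\<And>g. g \<in> box n \<Longrightarrow> (\<And>p. p \<in> W \<Longrightarrow> eval2 p g = 0) \<Longrightarrow> g = 0"
    and interp: "\<And>h. \<exists>r\<in>box n. \<forall>p\<in>W. eval2 p (h - r) = 0"
    and f: "f \<noteq> 0" "\<And>p. p \<in> W \<Longrightarrow> eval2 p f = 0"
  obtains g where "g \<in> box (n + 1)" "g \<noteq> 0" "\<And>p. p \<in> W \<Longrightarrow> eval2 p g = 0" "coprime f g"
proof -
  define G where "G = {g \<in> box (n + 1). \<forall>p\<in>W. eval2 p g = 0}"
  have "\<exists>g\<in>G. \<not> H dvd g" if "H \<in> prime_factors f" for H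
  proof (rule ccontr)
    assume "\<not> ?thesis"
    then have "H dvd 1"
      by (intro common_divisor_is_unit[OF W(1) faithful interp]) (auto simp: G_def)
    moreover have "prime H" using that by (rule in_prime_factors_imp_prime)
    ultimately show False by (simp add: not_prime_unit)
  qed
  moreover have "g + const2 c * h \<in> G" if "g \<in> G" "h \<in> G" for g h c
    using that by (auto simp: G_def intro!: box_add box_const_mult simp del: mult_pCons_left)
  moreover have "G \<noteq> {}" by (auto simp: G_def intro: exI[of _ 0])
  ultimately obtain g where g: "g \<in> G" "\<forall>H\<in>prime_factors f. \<not> H dvd g"
    using exists_avoiding_divisors[of "prime_factors f" G] by auto
  obtain p where p: "p \<in> W" using W by blast
  have prime_factor: "\<exists>H\<in>prime_factors f. H dvd e" if "e dvd f" "\<not> e dvd 1" for e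
  proof -
    have "e \<noteq> 0" using that f by auto
    from prime_divisor_exists[OF this that(2)] obtain H where H: "H dvd e" "prime H" by blast
    have "H dvd f" using H(1) that(1) by (rule dvd_trans)
    with H f(1) show ?thesis by (intro bexI[of _ H]) (simp_all add: in_prime_factors_iff)
  qed
  \<comment> \<open>Being a non-unit, \<open>f\<close> has a prime factor; it divides
    \<open>0\<close>, so the chosen \<open>g\<close> is non-zero.\<close>
  have "\<not> f dvd 1"
  proof
    assume "f dvd 1"
    then obtain f' where "1 = f * f'" by blast
    then have "eval2 p 1 = eval2 p f * eval2 p f'" by (metis eval2_simps(4))
    then show False using f p by simp
  qed
  then have "g \<noteq> 0" using prime_factor[of f] g by auto
  moreover have "coprime f g"
    using prime_factor g dvd_trans by (intro coprimeI) blast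
  ultimately show ?thesis using that g by (auto simp: G_def)
qed

theorem affine_waldschmidt_bound:
  assumes S: "finite S" and f: "f \<in> box k" "coeff2 f k k \<noteq> 0"
    and fS: "\<And>p. p \<in> S \<Longrightarrow> vanish m p f" and m: "m \<ge> 1"
    and faithful: "\<And>g. g \<in> box n \<Longrightarrow> (\<And>p. p \<in> S \<Longrightarrow> eval2 p g = 0) \<Longrightarrow> g = 0"
  shows "m * (n + 1) \<le> 2 * k"
proof -
  obtain W where W: "W \<subseteq> S" "(n + 1)\<^sup>2 \<le> card W"
    "\<And>g. g \<in> box n \<Longrightarrow> (\<And>p. p \<in> W \<Longrightarrow> eval2 p g = 0) \<Longrightarrow> g = 0"
    "\<And>h. \<exists>r\<in>box n. \<forall>p\<in>W. eval2 p (h - r) = 0"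
    using box_interpolation[OF S faithful] by metis
  have finW: "finite W" "W \<noteq> {}" using W(1,2) S finite_subset by auto
  have "eval2 p f = 0" if "p \<in> W" for p
    using fS[of p] W(1) that m by (auto simp: vanish_def simp flip: coeff2_taylor_0)
  moreover have "f \<noteq> 0" using f by auto
  ultimately obtain g where g: "g \<in> box (n + 1)" "g \<noteq> 0" "\<And>p. p \<in> W \<Longrightarrow> eval2 p g = 0" "coprime f g"
    using exists_coprime_vanishing[OF finW W(3,4), of f] by metis
  have "m * (n + 1)\<^sup>2 \<le> m * card W" using W(2) by simp
  also have "\<dots> \<le> 2 * k * (n + 1)"
    using mult_bezout[OF finW(1) f g(1,2,4) fS g(3)] W(1) by blast
  finally have "m * (n + 1) * (n + 1) \<le> 2 * k * (n + 1)" by (simp only: power2_eq_square mult.assoc)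
  then show ?thesis using mult_le_cancel2[of "m * (n + 1)" "n + 1" "2 * k"] by simp
qed

section \<open>Dehomogenization\<close>

definition ypoly :: "complex poly \<Rightarrow> complex poly poly" where
  "ypoly r = map_poly (\<lambda>c. [:c:]) r"

lemma coeff_ypoly: "coeff (ypoly r) j = [:coeff r j:]"
  by (simp add: ypoly_def coeff_map_poly)

lemma ypoly_mult: "ypoly (r * q) = ypoly r * ypoly q"
proof (rule poly2_eqI)
  show "coeff2 (ypoly (r * q)) i j = coeff2 (ypoly r * ypoly q) i j" for i j
    by (cases i) (simp_all add: coeff_ypoly coeff_mult coeff_sum mult.commute)
qed

lemma coeff2_xpoly_ypoly: "coeff2 ([:q:] * ypoly r) i j = coeff q i * coeff r j"
  by (simp add: coeff_ypoly)

text \<open>The chart sets X0 = x, X1 = 1 + e x, Y0 = y, Y1 = 1 + e' y, so that X1 - e X0 and Y1 -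
  e' Y0 become 1. The parameters can then be chosen so that the lines at infinity miss the given
  points and the form is non-zero where they meet.\<close>

definition affine_monomial :: "complex \<Rightarrow> complex \<Rightarrow> (var \<Rightarrow>\<^sub>0 nat) \<Rightarrow> complex poly poly" where
  "affine_monomial e e' t =
     [:[:0, 1:] ^ Poly_Mapping.lookup t X0 * [:1, e:] ^ Poly_Mapping.lookup t X1:] *
     ypoly ([:0, 1:] ^ Poly_Mapping.lookup t Y0 * [:1, e':] ^ Poly_Mapping.lookup t Y1)"

definition dehom :: "complex \<Rightarrow> complex \<Rightarrow> bipoly \<Rightarrow> complex poly poly" where
  "dehom e e' F = (\<Sum>t\<in>Poly_Mapping.keys F. const2 (Poly_Mapping.lookup F t) * affine_monomial e e' t)"

lemma affine_monomial_add:
  "affine_monomial e e' (s + t) = affine_monomial e e' s * affine_monomial e e' t"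
proof -
  have [simp]: "[:a * b:] = [:a:] * [:b:]" for a b :: "complex poly" by simp
  show ?thesis
    unfolding affine_monomial_def Poly_Mapping.lookup_add power_add
    by (simp add: ypoly_mult mult_ac del: mult_pCons_left mult_pCons_right)
qed

lemma dehom_add: "dehom e e' (F + G) = dehom e e' F + dehom e e' G"
  unfolding dehom_def
  by (rule setsum_keys_plus_distrib) (auto intro!: poly2_eqI simp: algebra_simps)

lemma dehom_0 [simp]: "dehom e e' 0 = 0"
  by (simp add: dehom_def)

lemma dehom_sum: "dehom e e' (sum F S) = (\<Sum>x\<in>S. dehom e e' (F x))"
  by (induction S rule: infinite_finite_induct) (auto simp: dehom_add)

lemma dehom_single: "dehom e e' (Poly_Mapping.single t c) = const2 c * affine_monomial e e' t"
  by (cases "c = 0") (simp_all add: dehom_def)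

lemma sum_single_lookup:
  "(\<Sum>t\<in>Poly_Mapping.keys F. Poly_Mapping.single t (Poly_Mapping.lookup F t)) = F"
proof (rule poly_mapping_eqI)
  fix t
  have "Poly_Mapping.lookup (\<Sum>t\<in>K. Poly_Mapping.single t (Poly_Mapping.lookup F t)) t
      = (if t \<in> K then Poly_Mapping.lookup F t else 0)" if "finite K" for K
    using that
    by (induction K rule: finite_induct) (auto simp: Poly_Mapping.lookup_add lookup_single when_def)
  then show "Poly_Mapping.lookup (\<Sum>t\<in>Poly_Mapping.keys F. Poly_Mapping.single t (Poly_Mapping.lookup F t)) t
      = Poly_Mapping.lookup F t"
    by (auto simp: in_keys_iff)
qed

lemma dehom_mult: "dehom e e' (F * G) = dehom e e' F * dehom e e' G"
proof -
  have single: "dehom e e' (Poly_Mapping.single s a * Poly_Mapping.single t b)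
      = dehom e e' (Poly_Mapping.single s a) * dehom e e' (Poly_Mapping.single t b)" for s t a b
  proof -
    have "const2 (a * b) = const2 a * const2 b" by simp
    then show ?thesis
      unfolding mult_single dehom_single affine_monomial_add by (simp only: mult_ac)
  qed
  have "dehom e e' (Poly_Mapping.single s a * G) = dehom e e' (Poly_Mapping.single s a) * dehom e e' G"
    for s a
  proof -
    have "dehom e e' (Poly_Mapping.single s a *
        (\<Sum>t\<in>Poly_Mapping.keys G. Poly_Mapping.single t (Poly_Mapping.lookup G t)))
      = dehom e e' (Poly_Mapping.single s a) *
        dehom e e' (\<Sum>t\<in>Poly_Mapping.keys G. Poly_Mapping.single t (Poly_Mapping.lookup G t))"
      unfolding sum_distrib_left dehom_sum single ..
    then show ?thesis unfolding sum_single_lookup .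
  qed
  then have "dehom e e' ((\<Sum>t\<in>Poly_Mapping.keys F. Poly_Mapping.single t (Poly_Mapping.lookup F t)) * G)
      = dehom e e' (\<Sum>t\<in>Poly_Mapping.keys F. Poly_Mapping.single t (Poly_Mapping.lookup F t)) * dehom e e' G"
    unfolding sum_distrib_right dehom_sum by simp
  then show ?thesis unfolding sum_single_lookup .
qed

lemma dehom_Const [simp]: "dehom e e' (Const c) = const2 c"
  by (simp add: Const_def dehom_single affine_monomial_def ypoly_def)

lemma Const_1: "Const 1 = 1"
  by (simp add: Const_def)

lemma dehom_1 [simp]: "dehom e e' 1 = 1"
  using dehom_Const[of e e' 1] by (simp add: Const_1 one_pCons)

lemma dehom_power: "dehom e e' (F ^ n) = dehom e e' F ^ n"
  by (induction n) (auto simp: dehom_mult)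

lemma dehom_uminus: "dehom e e' (- F) = - dehom e e' F"
proof -
  have "dehom e e' F + dehom e e' (- F) = 0" by (simp flip: dehom_add)
  then show ?thesis by (simp add: add_eq_0_iff)
qed

lemma dehom_diff: "dehom e e' (F - G) = dehom e e' F - dehom e e' G"
  using dehom_add[of e e' F "- G"] by (simp add: dehom_uminus)

lemma dehom_Var [simp]:
  "dehom e e' (Var X0) = mon 1 0"
  "dehom e e' (Var X1) = 1 + const2 e * mon 1 0"
  "dehom e e' (Var Y0) = mon 0 1"
  "dehom e e' (Var Y1) = 1 + const2 e' * mon 0 1"
  by (simp_all add: Var_def dehom_single affine_monomial_def ypoly_def mon_def monom_altdef
      lookup_single map_poly_pCons one_pCons)

lemma degree_power_mult_affine: "degree ([:0, 1:] ^ a * [:1, e:] ^ b) \<le> a + b"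
  for e :: complex
proof -
  have "degree ([:0, 1 :: complex:] ^ a) \<le> a" "degree ([:1, e:] ^ b) \<le> b"
    using degree_power_le[of "[:0, 1 :: complex:]" a] degree_power_le[of "[:1, e:]" b]
    by (auto split: if_splits)
  then show ?thesis using degree_mult_le[of "[:0, 1:] ^ a" "[:1, e:] ^ b"] by linarith
qed

lemma top_coeff_power_mult_affine: "coeff ([:0, 1:] ^ a * [:1, e:] ^ b) (a + b) = e ^ b"
  for e :: complex
proof (induction b)
  case 0
  show ?case by (simp add: monom_altdef[of 1 a, simplified, symmetric])
next
  case (Suc b)
  have "coeff ([:0, 1:] ^ a * [:1, e:] ^ b) (Suc (a + b)) = 0"
    using degree_power_mult_affine[of a e b] by (intro coeff_eq_0) simp
  moreover have "[:0, 1:] ^ a * [:1, e:] ^ Suc b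
      = [:0, 1:] ^ a * [:1, e:] ^ b + pCons 0 (smult e ([:0, 1:] ^ a * [:1, e:] ^ b))"
    by (simp add: algebra_simps)
  ultimately show ?case using Suc by simp
qed

lemma dehom_in_box:
  assumes "biform k k F"
  shows "dehom e e' F \<in> box k"
  unfolding dehom_def
proof (rule box_sum, rule box_const_mult)
  fix t assume "t \<in> Poly_Mapping.keys F"
  then have "Poly_Mapping.lookup t X0 + Poly_Mapping.lookup t X1 = k"
    "Poly_Mapping.lookup t Y0 + Poly_Mapping.lookup t Y1 = k"
    using assms by (auto simp: biform_def)
  then have "i \<le> k \<and> j \<le> k" if "coeff2 (affine_monomial e e' t) i j \<noteq> 0" for i j
    using that le_degree[THEN order_trans, OF _ degree_power_mult_affine]
    unfolding affine_monomial_def coeff2_xpoly_ypoly mult_eq_0_iff de_Morgan_disj by metis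
  then show "affine_monomial e e' t \<in> box k" by (simp add: box_def)
qed

lemma coeff2_dehom_top:
  assumes "biform k k F"
  shows "coeff2 (dehom e e' F) k k = (\<Sum>t\<in>Poly_Mapping.keys F. Poly_Mapping.lookup F t *
    (e ^ Poly_Mapping.lookup t X1 * e' ^ Poly_Mapping.lookup t Y1))"
  unfolding dehom_def coeff_sum coeff2_const_mult
proof (rule sum.cong[OF refl])
  fix t assume "t \<in> Poly_Mapping.keys F"
  then have k: "k = Poly_Mapping.lookup t X0 + Poly_Mapping.lookup t X1"
    "k = Poly_Mapping.lookup t Y0 + Poly_Mapping.lookup t Y1"
    using assms by (auto simp: biform_def)
  have "coeff2 (affine_monomial e e' t) k k
      = e ^ Poly_Mapping.lookup t X1 * e' ^ Poly_Mapping.lookup t Y1"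
    unfolding affine_monomial_def coeff2_xpoly_ypoly
    using top_coeff_power_mult_affine k by metis
  then show "Poly_Mapping.lookup F t * coeff2 (affine_monomial e e' t) k k
      = Poly_Mapping.lookup F t * (e ^ Poly_Mapping.lookup t X1 * e' ^ Poly_Mapping.lookup t Y1)"
    by simp
qed

text \<open>Outside finitely many \<open>e'\<close> a non-zero polynomial in x remains, and it has
  finitely many roots.\<close>

lemma poly2_nonzero_value:
  assumes "Q \<noteq> 0" "finite A" "finite B"
  shows "\<exists>e e'. e \<notin> A \<and> e' \<notin> B \<and> eval2 (e, e') Q \<noteq> 0"
proof -
  have "finite ((\<lambda>c. [:c:]) -` {z. poly Q z = 0})"
    using poly_roots_finite[OF assms(1)] by (intro finite_vimageI) (auto intro: injI)
  then obtain e' where e': "e' \<notin> B \<union> (\<lambda>c. [:c:]) -` {z. poly Q z = 0}"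
    using ex_new_if_finite[OF infinite_UNIV_char_0, of "B \<union> (\<lambda>c. [:c:]) -` {z. poly Q z = 0}"] assms(3)
    by auto
  then have "poly Q [:e':] \<noteq> 0" by auto
  from poly_roots_finite[OF this] obtain e where "e \<notin> A \<union> {z. poly (poly Q [:e':]) z = 0}"
    using ex_new_if_finite[OF infinite_UNIV_char_0, of "A \<union> {z. poly (poly Q [:e':]) z = 0}"] assms(2)
    by auto
  with e' show ?thesis by (auto simp: eval2_def)
qed

text \<open>The top coefficient is the value of the form at \<open>([1 : e], [1 : e'])\<close>, the point that
  becomes \<open>(\<infinity>, \<infinity>)\<close> in the affine chart.\<close>

lemma exists_good_chart:
  assumes F: "biform k k F" "F \<noteq> 0" and "finite A" "finite B"
  shows "\<exists>e e'. e \<notin> A \<and> e' \<notin> B \<and> coeff2 (dehom e e' F) k k \<noteq> 0"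
proof -
  define Q where "Q = (\<Sum>t\<in>Poly_Mapping.keys F. const2 (Poly_Mapping.lookup F t) *
    mon (Poly_Mapping.lookup t X1) (Poly_Mapping.lookup t Y1))"
  obtain t where t: "t \<in> Poly_Mapping.keys F" using F(2) by (metis all_not_in_conv keys_eq_empty)
  \<comment> \<open>The bi-degree recovers the exponents of X0 and Y0 from those of X1 and Y1, so no
    terms merge in \<open>Q\<close>.\<close>
  have unique: "s = t"
    if "s \<in> Poly_Mapping.keys F" "Poly_Mapping.lookup s X1 = Poly_Mapping.lookup t X1"
      "Poly_Mapping.lookup s Y1 = Poly_Mapping.lookup t Y1" for s
  proof (rule poly_mapping_eqI)
    fix v show "Poly_Mapping.lookup s v = Poly_Mapping.lookup t v"
      using that t F(1) unfolding biform_def by (cases v) (metis add_right_cancel)+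
  qed
  have "coeff2 Q (Poly_Mapping.lookup t X1) (Poly_Mapping.lookup t Y1)
      = (\<Sum>s\<in>Poly_Mapping.keys F. if s = t then Poly_Mapping.lookup F t else 0)"
    unfolding Q_def coeff_sum coeff2_const_mult
    by (intro sum.cong) (use unique in \<open>auto simp: coeff2_mon\<close>)
  then have "Q \<noteq> 0" using t by (auto simp: in_keys_iff)
  from poly2_nonzero_value[OF this assms(3,4)] obtain e e'
    where e: "e \<notin> A" "e' \<notin> B" "eval2 (e, e') Q \<noteq> 0" by blast
  have "eval2 (e, e') (mon i j) = e ^ i * e' ^ j" for i j
    by (simp add: eval2_def mon_def poly_monom flip: poly_const_pow)
  then have "eval2 (e, e') Q = coeff2 (dehom e e' F) k k"
    unfolding coeff2_dehom_top[OF F(1)] Q_def eval2_sum eval2_simps by simp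
  with e show ?thesis by auto
qed

section \<open>Ideal powers and multiplicities\<close>

lemma CX_simps [simp]:
  "carrier CX = UNIV" "monoid.mult CX = (*)" "ring.add CX = (+)" "ring.zero CX = 0" "monoid.one CX = 1"
  by (auto simp: ring_of_type_algebra_def)

lemma ideal_CX_closed:
  assumes "ideal I CX"
  shows "0 \<in> I" "a \<in> I \<Longrightarrow> b \<in> I \<Longrightarrow> a + b \<in> I" "a \<in> I \<Longrightarrow> c * a \<in> I"
  using additive_subgroup.zero_closed[OF ideal.axioms(1)[OF assms]]
    additive_subgroup.a_closed[OF ideal.axioms(1)[OF assms], of a b]
    ideal.I_l_closed[OF assms, of a c]
  by simp_all

lemma ideal_CX_I:
  assumes zero: "0 \<in> I" and add: "\<And>a b. a \<in> I \<Longrightarrow> b \<in> I \<Longrightarrow> a + b \<in> I"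
    and mult: "\<And>a c. a \<in> I \<Longrightarrow> c * a \<in> I"
  shows "ideal I CX"
proof (rule idealI)
  show ring: "ring CX" by (rule ring_from_type_algebra)
  show "subgroup I (add_monoid CX)"
  proof (rule group.subgroupI)
    show "group (add_monoid CX)" using ring by (rule abelian_group.a_group[OF ring.is_abelian_group])
    show "inv\<^bsub>add_monoid CX\<^esub> a \<in> I" if "a \<in> I" for a
    proof -
      have "\<ominus>\<^bsub>CX\<^esub> a = - a"
        using abelian_group.minus_equality[OF ring.is_abelian_group[OF ring], of "- a" a] by simp
      then show ?thesis using mult[OF that, of "- 1"] by (simp add: a_inv_def)
    qed
  qed (use zero add in auto)
qed (use mult in \<open>simp_all add: mult.commute\<close>)

lemma ideal_power_CX:
  assumes "ideal I CX"
  shows "ideal (I [^]\<^bsub>ideals_set CX\<^esub> (m :: nat)) CX"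
proof (induction m)
  case 0
  show ?case by (intro ideal_CX_I) (simp_all add: nat_pow_def ideals_set_def)
next
  case (Suc m)
  from ring.ideal_prod_is_ideal[OF ring_from_type_algebra this assms]
  show ?case by (simp add: nat_pow_def ideals_set_def)
qed

lemma power_in_ideal_power:
  assumes "x \<in> I"
  shows "x ^ m \<in> I [^]\<^bsub>ideals_set CX\<^esub> (m :: nat)"
proof (induction m)
  case 0
  show ?case by (simp add: nat_pow_def ideals_set_def)
next
  case (Suc m)
  from ideal_prod.prod[OF this assms, of CX] show ?case
    by (simp add: nat_pow_def ideals_set_def mult.commute)
qed

text \<open>Each factor from \<open>I\<close> adds one to the order of vanishing, and the sums in
  \<open>ideal_prod\<close> preserve it.\<close>

lemma ideal_power_vanish:
  assumes I: "\<And>F. F \<in> I \<Longrightarrow> vanish 1 p (dehom e e' F)"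
    and F: "F \<in> I [^]\<^bsub>ideals_set CX\<^esub> (m :: nat)"
  shows "vanish m p (dehom e e' F)"
  using F
proof (induction m arbitrary: F)
  case 0
  show ?case by simp
next
  case (Suc m)
  then have "F \<in> ideal_prod CX (I [^]\<^bsub>ideals_set CX\<^esub> m) I"
    by (simp add: nat_pow_def ideals_set_def)
  then show ?case
  proof (induction rule: ideal_prod.induct)
    case (prod i j)
    from vanish_mult[OF Suc.IH[OF prod(1)] I[OF prod(2)]] show ?case by (simp add: dehom_mult)
  next
    case (sum s1 s2)
    then show ?case by (simp add: dehom_add vanish_add)
  qed
qed

lemma point_ideal_generators:
  obtains a b c d where "(a, b) \<noteq> (0, 0)" "(c, d) \<noteq> (0, 0)"
    "point_ideal P = Idl\<^bsub>CX\<^esub> {Const b * Var X0 - Const a * Var X1, Const d * Var Y0 - Const c * Var Y1}"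
proof -
  have rep: "\<exists>v. proportional v v \<and> x = abs_proj_line v" for x
    by (induction x rule: proj_line.abs_induct) blast
  obtain v w where v: "proportional v v" "fst P = abs_proj_line v"
    and w: "proportional w w" "snd P = abs_proj_line w"
    using rep by blast
  obtain a b c d where "v = (a, b)" "w = (c, d)" by (cases v; cases w)
  with that[of a b c d] v w show ?thesis
    by (simp add: point_ideal_def point_ideal_aux.abs_eq proportional_def)
qed

lemma generators_in_Idl: "S \<subseteq> Idl\<^bsub>CX\<^esub> S"
  and ideal_Idl: "ideal (Idl\<^bsub>CX\<^esub> S) CX"
  using ring.genideal_self[OF ring_from_type_algebra, of S]
    ring.genideal_ideal[OF ring_from_type_algebra, of S] by simp_all

text \<open>The first coordinate of [a : b] once rescaled to X1 - e X0 = 1; the denominator is zero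
  exactly for the point at infinity of the chart.\<close>

definition affine_coord :: "complex \<Rightarrow> complex \<Rightarrow> complex \<Rightarrow> complex" where
  "affine_coord e a b = a / (b - e * a)"

text \<open>The polynomials whose dehomogenization is zero at the affine point form an ideal
  containing both generators.\<close>

lemma point_ideal_vanish:
  assumes ne: "b - e * a \<noteq> 0" "d - e' * c \<noteq> 0"
    and F: "F \<in> Idl\<^bsub>CX\<^esub> {Const b * Var X0 - Const a * Var X1, Const d * Var Y0 - Const c * Var Y1}"
  shows "vanish 1 (affine_coord e a b, affine_coord e' c d) (dehom e e' F)"
proof -
  let ?p = "(affine_coord e a b, affine_coord e' c d)"
  let ?Z = "{F. eval2 ?p (dehom e e' F) = 0}"
  have mon: "eval2 p (mon 1 0) = fst p" "eval2 p (mon 0 1) = snd p" for p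
    by (simp_all add: eval2_def mon_def monom_altdef)
  have "ideal ?Z CX"
    by (rule ideal_CX_I) (auto simp: dehom_add dehom_mult)
  moreover have "{Const b * Var X0 - Const a * Var X1, Const d * Var Y0 - Const c * Var Y1} \<subseteq> ?Z"
    using ne by (auto simp: dehom_diff dehom_mult mon affine_coord_def field_simps
        simp del: mult_pCons_left mult_pCons_right One_nat_def)
  ultimately have "Idl\<^bsub>CX\<^esub> {Const b * Var X0 - Const a * Var X1, Const d * Var Y0 - Const c * Var Y1} \<subseteq> ?Z"
    by (rule ring.genideal_minimal[OF ring_from_type_algebra])
  with F show ?thesis unfolding vanish_1 by blast
qed

section \<open>Forms and homogenization\<close>

lemma biform_0: "biform k l 0"
  by (simp add: biform_def)

lemma biform_add: "biform k l F \<Longrightarrow> biform k l G \<Longrightarrow> biform k l (F + G)"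
  unfolding biform_def using Poly_Mapping.keys_add[of F G] by blast

lemma biform_mult: "biform k l F \<Longrightarrow> biform k' l' G \<Longrightarrow> biform (k + k') (l + l') (F * G)"
  unfolding biform_def using keys_mult[of F G] by (fastforce simp: Poly_Mapping.lookup_add)

lemma biform_sum: "(\<And>x. x \<in> S \<Longrightarrow> biform k l (F x)) \<Longrightarrow> biform k l (sum F S)"
  by (induction S rule: infinite_finite_induct) (auto intro: biform_add biform_0)

lemma biform_Const: "biform 0 0 (Const c)"
  by (cases "c = 0") (auto simp: biform_def Const_def)

lemma biform_Const_mult: "biform k l F \<Longrightarrow> biform k l (Const c * F)"
  using biform_mult[OF biform_Const, of k l F c] by simp

lemma biform_uminus: "biform k l F \<Longrightarrow> biform k l (- F)"
  by (simp add: biform_def)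

lemma biform_diff: "biform k l F \<Longrightarrow> biform k l G \<Longrightarrow> biform k l (F - G)"
  using biform_add[OF _ biform_uminus] by fastforce

lemma biform_power: "biform k l F \<Longrightarrow> biform (n * k) (n * l) (F ^ n)"
proof (induction n)
  case 0
  show ?case using biform_Const[of 1] by (simp add: Const_1)
next
  case (Suc n)
  then show ?case using biform_mult by fastforce
qed

lemma biform_Var:
  "biform 1 0 (Var X0)" "biform 1 0 (Var X1)" "biform 0 1 (Var Y0)" "biform 0 1 (Var Y1)"
  by (auto simp: biform_def Var_def lookup_single)

text \<open>This is \<open>h\<close> at x = X0 / (X1 - e X0) and y = Y0 / (Y1 - e' Y0), with
  denominators cleared by \<open>n\<close>-th powers.\<close>

definition homog :: "complex \<Rightarrow> complex \<Rightarrow> nat \<Rightarrow> complex poly poly \<Rightarrow> bipoly" where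
  "homog e e' n h = (\<Sum>t\<in>{..n} \<times> {..n}. Const (coeff2 h (fst t) (snd t)) *
     ((Var X0 ^ fst t * (Var X1 - Const e * Var X0) ^ (n - fst t)) *
      (Var Y0 ^ snd t * (Var Y1 - Const e' * Var Y0) ^ (n - snd t))))"

lemma biform_homog: "biform n n (homog e e' n h)"
  unfolding homog_def
proof (intro biform_sum biform_Const_mult)
  fix t assume t: "t \<in> {..n} \<times> {..n}"
  have "biform 1 0 (Var X1 - Const e * Var X0)" "biform 0 1 (Var Y1 - Const e' * Var Y0)"
    by (intro biform_diff biform_Const_mult biform_Var)+
  then have "biform ((fst t * 1 + (n - fst t) * 1) + (snd t * 0 + (n - snd t) * 0))
     ((fst t * 0 + (n - fst t) * 0) + (snd t * 1 + (n - snd t) * 1))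
     ((Var X0 ^ fst t * (Var X1 - Const e * Var X0) ^ (n - fst t)) *
      (Var Y0 ^ snd t * (Var Y1 - Const e' * Var Y0) ^ (n - snd t)))"
    by (intro biform_mult biform_power biform_Var)
  with t show "biform n n ((Var X0 ^ fst t * (Var X1 - Const e * Var X0) ^ (n - fst t)) *
      (Var Y0 ^ snd t * (Var Y1 - Const e' * Var Y0) ^ (n - snd t)))"
    by (simp add: mem_Times_iff)
qed

lemma dehom_homog:
  assumes "h \<in> box n"
  shows "dehom e e' (homog e e' n h) = h"
proof -
  have "mon 1 0 ^ a = mon a 0" "mon 0 1 ^ a = mon 0 a" for a
    by (induction a) (simp_all add: mon_mult)
  moreover have "dehom e e' (Var X1 - Const e * Var X0) = 1" "dehom e e' (Var Y1 - Const e' * Var Y0) = 1"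
    by (simp_all add: dehom_diff dehom_mult)
  ultimately have "dehom e e' (homog e e' n h)
      = (\<Sum>t\<in>{..n} \<times> {..n}. const2 (coeff2 h (fst t) (snd t)) * mon (fst t) (snd t))"
    unfolding homog_def dehom_sum dehom_mult dehom_power dehom_Const dehom_Var
    by (simp add: mon_mult del: mult_pCons_left)
  then show ?thesis using box_expansion[OF assms] by simp
qed

text \<open>Modulo the ideal of the point, \<open>X0\<close> is the affine coordinate times the linear form that
  is dehomogenized to \<open>1\<close>, and likewise for \<open>Y0\<close>.\<close>

lemma homog_in_point_ideal:
  assumes ne: "b - e * a \<noteq> 0" "d - e' * c \<noteq> 0" and h: "h \<in> box n"
    and zero: "eval2 (affine_coord e a b, affine_coord e' c d) h = 0"
  shows "homog e e' n h \<in>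
    Idl\<^bsub>CX\<^esub> {Const b * Var X0 - Const a * Var X1, Const d * Var Y0 - Const c * Var Y1}"
proof -
  let ?I = "Idl\<^bsub>CX\<^esub> {Const b * Var X0 - Const a * Var X1, Const d * Var Y0 - Const c * Var Y1}"
  note I = ideal_CX_closed[OF ideal_Idl[of "{Const b * Var X0 - Const a * Var X1, Const d * Var Y0 - Const c * Var Y1}"]]
  define u v where "u = affine_coord e a b" and "v = affine_coord e' c d"
  define L M where "L = Var X1 - Const e * Var X0" and "M = Var Y1 - Const e' * Var Y0"
  have Const_hom: "Const (x + y) = Const x + Const y" "Const (x - y) = Const x - Const y"
    "Const (x * y) = Const x * Const y" for x y
    by (simp_all add: Const_def mult_single single_add single_diff)
  have linear: "Z - Const (s / (r - \<epsilon> * s)) * (Z' - Const \<epsilon> * Z)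
      = Const (1 / (r - \<epsilon> * s)) * (Const r * Z - Const s * Z')"
    if "r - \<epsilon> * s \<noteq> 0" for r s \<epsilon> Z Z'
  proof -
    let ?w = "r - \<epsilon> * s"
    have "Const (1 / ?w) * Const r = 1 + Const (s / ?w) * Const \<epsilon>"
      using that by (simp add: field_simps flip: Const_hom Const_1)
    moreover have "Const (1 / ?w) * Const s = Const (s / ?w)"
      by (simp flip: Const_hom)
    moreover have "Const (1 / ?w) * (Const r * Z - Const s * Z')
        = (Const (1 / ?w) * Const r) * Z - (Const (1 / ?w) * Const s) * Z'"
      by (simp add: algebra_simps)
    ultimately show ?thesis by (simp only:) (simp add: algebra_simps)
  qed
  have "Var X0 - Const u * L \<in> ?I"
    unfolding u_def affine_coord_def L_def linear[OF ne(1)]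
    using generators_in_Idl by (intro I(3)) blast
  moreover have "Var Y0 - Const v * M \<in> ?I"
    unfolding v_def affine_coord_def M_def linear[OF ne(2)]
    using generators_in_Idl by (intro I(3)) blast
  ultimately have gens: "Var X0 - Const u * L \<in> ?I" "Var Y0 - Const v * M \<in> ?I" by auto
  have power: "x ^ i - y ^ i \<in> ?I" if "x - y \<in> ?I" for x y i
  proof -
    obtain z where "x ^ i - y ^ i = z * (x - y)"
      by (metis power_diff_sumr2 mult.commute)
    then show ?thesis using I(3)[OF that] by simp
  qed
  have prod: "x * y - x' * y' \<in> ?I" if "x - x' \<in> ?I" "y - y' \<in> ?I" for x x' y y'
  proof -
    have "x * y - x' * y' = x * (y - y') + y' * (x - x')" by (simp add: algebra_simps)
    then show ?thesis using I(2)[OF I(3)[OF that(2)] I(3)[OF that(1)]] by metis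
  qed
  have sum: "(\<Sum>t\<in>T. f t) \<in> ?I" if "\<And>t. t \<in> T \<Longrightarrow> f t \<in> ?I" for f and T :: "(nat \<times> nat) set"
    using that by (induction T rule: infinite_finite_induct) (auto intro: I)
  \<comment> \<open>In \<open>?m'\<close> the variables X0 and Y0 are replaced by their residues.
    Each \<open>?m'\<close> is a constant times \<open>L ^ n * M ^ n\<close>, so the weighted sum is
    the value of \<open>h\<close> at the point times that product, hence zero.\<close>
  let ?m = "\<lambda>t. (Var X0 ^ fst t * L ^ (n - fst t)) * (Var Y0 ^ snd t * M ^ (n - snd t))"
  let ?m' = "\<lambda>t. ((Const u * L) ^ fst t * L ^ (n - fst t)) * ((Const v * M) ^ snd t * M ^ (n - snd t))"
  have refl: "x - x \<in> ?I" for x using I(1) by simp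
  have "(\<Sum>t\<in>{..n} \<times> {..n}. Const (coeff2 h (fst t) (snd t)) * (?m t - ?m' t)) \<in> ?I"
    by (intro sum I(3) prod power gens refl)
  moreover have "(\<Sum>t\<in>{..n} \<times> {..n}. Const (coeff2 h (fst t) (snd t)) * ?m' t) = 0"
  proof -
    have Const_power: "Const x ^ i = Const (x ^ i)" for x i
      by (induction i) (simp_all add: Const_1 Const_hom)
    have Const_sum: "(\<Sum>t\<in>T. Const (f t)) = Const (sum f T)" for f and T :: "(nat \<times> nat) set"
      by (induction T rule: infinite_finite_induct) (simp_all add: Const_hom, simp_all add: Const_def)
    have mon: "eval2 (u, v) (mon i j) = u ^ i * v ^ j" for i j
      by (simp add: eval2_def mon_def poly_monom flip: poly_const_pow)
    have "Const (coeff2 h (fst t) (snd t)) * ?m' t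
        = Const (coeff2 h (fst t) (snd t) * eval2 (u, v) (mon (fst t) (snd t))) * (L ^ n * M ^ n)"
      if "t \<in> {..n} \<times> {..n}" for t
    proof -
      have "L ^ n = L ^ fst t * L ^ (n - fst t)" "M ^ n = M ^ snd t * M ^ (n - snd t)"
        using that by (auto simp flip: power_add)
      then show ?thesis
        unfolding mon Const_hom power_mult_distrib Const_power by (simp only: mult_ac)
    qed
    then have "(\<Sum>t\<in>{..n} \<times> {..n}. Const (coeff2 h (fst t) (snd t)) * ?m' t)
        = Const (\<Sum>t\<in>{..n} \<times> {..n}. coeff2 h (fst t) (snd t) * eval2 (u, v) (mon (fst t) (snd t))) * (L ^ n * M ^ n)"
      by (simp add: sum_distrib_right flip: Const_sum)
    also have "(\<Sum>t\<in>{..n} \<times> {..n}. coeff2 h (fst t) (snd t) * eval2 (u, v) (mon (fst t) (snd t)))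
        = eval2 (u, v) (\<Sum>t\<in>{..n} \<times> {..n}. const2 (coeff2 h (fst t) (snd t)) * mon (fst t) (snd t))"
      unfolding eval2_sum eval2_simps ..
    also have "\<dots> = 0" using zero box_expansion[OF h] by (simp add: u_def v_def)
    finally show ?thesis by (simp add: Const_def)
  qed
  ultimately show ?thesis
    by (simp add: homog_def L_def M_def right_diff_distrib sum_subtractf)
qed

lemma linear_form_nonzero:
  assumes "(a, b) \<noteq> (0, 0)"
  shows "Const b * Var X0 - Const a * Var X1 \<noteq> 0"
proof
  assume "Const b * Var X0 - Const a * Var X1 = 0"
  then have zero: "Poly_Mapping.lookup (Const b * Var X0 - Const a * Var X1) (Poly_Mapping.single v 1) = 0" for v
    by simp
  moreover have "Poly_Mapping.single X0 (1 :: nat) \<noteq> Poly_Mapping.single X1 1"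
    by (metis lookup_single_eq lookup_single_not_eq var.distinct(1) zero_neq_one)
  ultimately show False
    using assms zero[of X0] zero[of X1] by (simp add: Const_def Var_def mult_single lookup_minus lookup_single when_def)
qed

text \<open>Guarantees that the minimum in \<open>alpha_star\<close> is attained: each point lies on
  a line of one ruling, and the product of the \<open>m\<close>-th powers of the equations lies in
  every ideal power.\<close>

lemma symbolic_power_nonzero_form:
  "\<exists>k. \<exists>F\<in>symbolic_power P s m. F \<noteq> 0 \<and> biform k k F"
proof -
  have "\<exists>l. l \<in> point_ideal (P i) \<and> l \<noteq> 0 \<and> biform 1 0 l" for i
  proof -
    obtain a b c d where P: "(a, b) \<noteq> (0, 0)"
      "point_ideal (P i) = Idl\<^bsub>CX\<^esub> {Const b * Var X0 - Const a * Var X1, Const d * Var Y0 - Const c * Var Y1}"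
      by (rule point_ideal_generators)
    moreover have "biform 1 0 (Const b * Var X0 - Const a * Var X1)"
      by (intro biform_diff biform_Const_mult biform_Var)
    ultimately show ?thesis using generators_in_Idl linear_form_nonzero by blast
  qed
  then obtain l where l: "\<And>i. l i \<in> point_ideal (P i)" "\<And>i. l i \<noteq> 0" "\<And>i. biform 1 0 (l i)"
    by metis
  have ideal: "ideal (point_ideal Q) CX" for Q
    by (metis point_ideal_generators ideal_Idl)
  define A where "A = (\<Prod>i\<in>{1..s}. l i ^ m)"
  have "biform (card T * m) 0 (\<Prod>i\<in>T. l i ^ m)" if "finite T" for T
    using that
  proof (induction T rule: finite_induct)
    case empty
    show ?case using biform_Const[of 1] by (simp add: Const_1)
  next
    case (insert i T)
    then show ?case using biform_mult[OF biform_power[OF l(3), of m i] insert.IH] by simp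
  qed
  then have "biform (s * m) 0 A" unfolding A_def by (metis card_atLeastAtMost diff_Suc_1 finite_atLeastAtMost)
  \<comment> \<open>The power of Y0 balances the bi-degree.\<close>
  then have "biform (s * m) (s * m) (Var Y0 ^ (s * m) * A)"
    using biform_mult[OF biform_power[OF biform_Var(3), of "s * m"]] by fastforce
  moreover have "Var Y0 \<noteq> 0" unfolding Var_def by (metis lookup_single_eq lookup_zero one_neq_zero)
  then have "Var Y0 ^ (s * m) * A \<noteq> 0" using l(2) by (simp add: A_def)
  moreover have "Var Y0 ^ (s * m) * A \<in> symbolic_power P s m"
    unfolding symbolic_power_def
  proof
    fix i assume "i \<in> {1..s}"
    then have "A = (\<Prod>j\<in>{1..s} - {i}. l j ^ m) * l i ^ m"
      by (simp add: A_def prod.remove mult.commute)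
    then show "Var Y0 ^ (s * m) * A \<in> point_ideal (P i) [^]\<^bsub>ideals_set CX\<^esub> m"
      using power_in_ideal_power[OF l(1)] ideal_CX_closed(3)[OF ideal_power_CX[OF ideal]] by metis
  qed
  ultimately show ?thesis by blast
qed

theorem theorem2p9:
  fixes P :: "nat \<Rightarrow> point" and s m :: nat
  assumes distinct_points: "inj_on P {1..s}"
    and "m \<ge> 1"
  shows "real (alpha_star (symbolic_power P s m)) / real m \<ge> real (alpha_star (points_ideal P s)) / 2"
proof (cases "alpha_star (points_ideal P s)")
  case 0
  then show ?thesis by simp
next
  case (Suc n)
  define k where "k = alpha_star (symbolic_power P s m)"
  obtain F where F: "F \<in> symbolic_power P s m" "F \<noteq> 0" "biform k k F"
    using LeastI_ex[OF symbolic_power_nonzero_form, of P s m] unfolding k_def alpha_star_def by blast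
  have "\<exists>a b c d. (a, b) \<noteq> (0, 0) \<and> (c, d) \<noteq> (0, 0) \<and>
    point_ideal (P i) = Idl\<^bsub>CX\<^esub> {Const b * Var X0 - Const a * Var X1, Const d * Var Y0 - Const c * Var Y1}" for i
    by (rule point_ideal_generators) blast
  then obtain a b c d where ab: "\<And>i. (a i, b i) \<noteq> (0, 0)" "\<And>i. (c i, d i) \<noteq> (0, 0)"
    and ideal: "\<And>i. point_ideal (P i) = Idl\<^bsub>CX\<^esub> {Const (b i) * Var X0 - Const (a i) * Var X1,
      Const (d i) * Var Y0 - Const (c i) * Var Y1}"
    by metis
  \<comment> \<open>If \<open>a i = 0\<close>, the quotient is \<open>0\<close> by convention and
    only excludes one further value of \<open>e\<close>; the denominator
    \<open>b i - e * a i\<close> is then \<open>b i\<close>, which is non-zero. The same holds for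
    \<open>c i\<close>.\<close>
  obtain e e' where e: "e \<notin> (\<lambda>i. b i / a i) ` {1..s}" "e' \<notin> (\<lambda>i. d i / c i) ` {1..s}"
    and top: "coeff2 (dehom e e' F) k k \<noteq> 0"
    using exists_good_chart[OF F(3,2), of "(\<lambda>i. b i / a i) ` {1..s}" "(\<lambda>i. d i / c i) ` {1..s}"] by auto
  have ne: "b i - e * a i \<noteq> 0" "d i - e' * c i \<noteq> 0" if "i \<in> {1..s}" for i
  proof -
    have "e \<noteq> b i / a i" "e' \<noteq> d i / c i" using that e by auto
    with ab[of i] show "b i - e * a i \<noteq> 0" "d i - e' * c i \<noteq> 0"
      by (cases "a i = 0"; cases "c i = 0"; simp add: field_simps)+
  qed
  define S where "S = (\<lambda>i. (affine_coord e (a i) (b i), affine_coord e' (c i) (d i))) ` {1..s}"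
  have "m * (n + 1) \<le> 2 * k"
  proof (rule affine_waldschmidt_bound[where f = "dehom e e' F" and S = S])
    show "finite S" by (simp add: S_def)
    show "dehom e e' F \<in> box k" using F(3) by (rule dehom_in_box)
    show "vanish m p (dehom e e' F)" if p: "p \<in> S" for p
    proof -
      obtain i where i: "i \<in> {1..s}" "p = (affine_coord e (a i) (b i), affine_coord e' (c i) (d i))"
        using p by (auto simp: S_def)
      then have "F \<in> point_ideal (P i) [^]\<^bsub>ideals_set CX\<^esub> m"
        using F(1) by (auto simp: symbolic_power_def)
      then show ?thesis unfolding i(2)
        by (rule ideal_power_vanish[rotated]) (use point_ideal_vanish ne i(1) ideal in metis)
    qed
    show "g = 0" if g: "g \<in> box n" and zero: "\<And>p. p \<in> S \<Longrightarrow> eval2 p g = 0" for g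
    proof (rule ccontr)
      \<comment> \<open>Homogenizing \<open>g\<close> would give a non-zero form of bi-degree (n, n)
        in the ideal, below the minimum \<open>n + 1\<close>.\<close>
      assume "g \<noteq> 0"
      then have "homog e e' n g \<noteq> 0" using dehom_homog[OF g, of e e'] by auto
      moreover have "homog e e' n g \<in> points_ideal P s"
        unfolding points_ideal_def ideal
        using homog_in_point_ideal[OF ne g zero] by (auto simp: S_def)
      ultimately have "alpha_star (points_ideal P s) \<le> n"
        unfolding alpha_star_def using biform_homog by (intro Least_le) blast
      with Suc show False by simp
    qed
  qed (use top assms in auto)
  then have "real m * real (n + 1) \<le> 2 * real k" by (metis of_nat_le_iff of_nat_mult of_nat_numeral)
  then show ?thesis using assms(2) Suc by (simp add: k_def field_simps)
qed

end
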